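(* There exists an Orlicz function $\Phi$ such that the Orlicz space $L_\Phi$ is $(1-DH)$ but the Orlicz space $L_\Psi$, where $\Psi$ is the Young conjugate of $\Phi$ (the dual space of $L_\Phi$), is not $DH$.
   Context: An Orlicz function is an increasing convex function on $[0,\infty)$ vanishing at $0$ and tending to $\infty$; its Young conjugate is $\Psi(u)=\sup_{t>0}(ut-\Phi(t))$. $L_\Phi$ is the Orlicz space on $[0,1]$ with Luxemburg norm $\|f\|=\inf\{\lambda>0:\int_0^1\Phi(|f|/\lambda)\le1\}$. A Banach lattice $X$ is $DH$ (disjointly homogeneous) if any two sequences $(x_n),(y_n)$ of pairwise disjoint norm-one elements have subsequences $(x_{n_k}),(y_{n_k})$ (along a common index sequence) that are equivalent; it is $(1-DH)$ if every sequence of pairwise disjoint norm-one elements has a subsequence equivalent to the unit vector basis of $\ell_1$. *)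

theory Defs
  imports "HOL-Analysis.Analysis"
begin

definition orlicz_function :: "(real \<Rightarrow> real) \<Rightarrow> bool" where
  "orlicz_function \<Phi> \<longleftrightarrow> \<Phi> 0 = 0 \<and> mono_on {0..} \<Phi> \<and> convex_on {0..} \<Phi>
     \<and> filterlim \<Phi> at_top at_top"

definition young_conj :: "(real \<Rightarrow> real) \<Rightarrow> real \<Rightarrow> real" where
  "young_conj \<Phi> u = (SUP t\<in>{0<..}. u * t - \<Phi> t)"

definition orlicz_mod :: "(real \<Rightarrow> real) \<Rightarrow> (real \<Rightarrow> real) \<Rightarrow> real \<Rightarrow> ennreal" where
  "orlicz_mod \<Phi> f l = (\<integral>\<^sup>+ x\<in>{0..1}. ennreal (\<Phi> (\<bar>f x\<bar> / l)) \<partial>lebesgue)"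

definition in_orlicz :: "(real \<Rightarrow> real) \<Rightarrow> (real \<Rightarrow> real) \<Rightarrow> bool" where
  "in_orlicz \<Phi> f \<longleftrightarrow> f \<in> borel_measurable lebesgue \<and> (\<exists>l>0. orlicz_mod \<Phi> f l \<le> 1)"

definition lux_norm :: "(real \<Rightarrow> real) \<Rightarrow> (real \<Rightarrow> real) \<Rightarrow> real" where
  "lux_norm \<Phi> f = Inf {l. l > 0 \<and> orlicz_mod \<Phi> f l \<le> 1}"

text \<open>Pairwise disjoint (as elements of the function lattice on [0,1], i.e. up to null sets).\<close>
definition pairwise_disjoint_seq :: "(nat \<Rightarrow> real \<Rightarrow> real) \<Rightarrow> bool" where
  "pairwise_disjoint_seq x \<longleftrightarrow>
     (\<forall>n m. n \<noteq> m \<longrightarrow> emeasure lebesgue {t\<in>{0..1}. x n t \<noteq> 0 \<and> x m t \<noteq> 0} = 0)"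

definition normalized_disjoint :: "(real \<Rightarrow> real) \<Rightarrow> (nat \<Rightarrow> real \<Rightarrow> real) \<Rightarrow> bool" where
  "normalized_disjoint \<Phi> x \<longleftrightarrow>
     (\<forall>n. in_orlicz \<Phi> (x n) \<and> lux_norm \<Phi> (x n) = 1) \<and> pairwise_disjoint_seq x"

definition lin_comb :: "(nat \<Rightarrow> real) \<Rightarrow> (nat \<Rightarrow> real \<Rightarrow> real) \<Rightarrow> nat \<Rightarrow> real \<Rightarrow> real" where
  "lin_comb a x n = (\<lambda>t. \<Sum>i<n. a i * x i t)"

definition seq_equiv :: "(real \<Rightarrow> real) \<Rightarrow> (nat \<Rightarrow> real \<Rightarrow> real) \<Rightarrow> (nat \<Rightarrow> real \<Rightarrow> real) \<Rightarrow> bool" where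
  "seq_equiv \<Phi> x y \<longleftrightarrow> (\<exists>C>0. \<forall>n a.
      lux_norm \<Phi> (lin_comb a x n) \<le> C * lux_norm \<Phi> (lin_comb a y n) \<and>
      lux_norm \<Phi> (lin_comb a y n) \<le> C * lux_norm \<Phi> (lin_comb a x n))"

definition l1_equiv :: "(real \<Rightarrow> real) \<Rightarrow> (nat \<Rightarrow> real \<Rightarrow> real) \<Rightarrow> bool" where
  "l1_equiv \<Phi> x \<longleftrightarrow> (\<exists>C>0. \<forall>n a.
      lux_norm \<Phi> (lin_comb a x n) \<le> C * (\<Sum>i<n. \<bar>a i\<bar>) \<and>
      (\<Sum>i<n. \<bar>a i\<bar>) \<le> C * lux_norm \<Phi> (lin_comb a x n))"

definition DH :: "(real \<Rightarrow> real) \<Rightarrow> bool" where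
  "DH \<Phi> \<longleftrightarrow> (\<forall>x y. normalized_disjoint \<Phi> x \<and> normalized_disjoint \<Phi> y \<longrightarrow>
      (\<exists>\<sigma>::nat\<Rightarrow>nat. strict_mono \<sigma> \<and> seq_equiv \<Phi> (x \<circ> \<sigma>) (y \<circ> \<sigma>)))"

definition one_DH :: "(real \<Rightarrow> real) \<Rightarrow> bool" where
  "one_DH \<Phi> \<longleftrightarrow> (\<forall>x. normalized_disjoint \<Phi> x \<longrightarrow>
      (\<exists>\<sigma>::nat\<Rightarrow>nat. strict_mono \<sigma> \<and> l1_equiv \<Phi> (x \<circ> \<sigma>)))"

end

(*
  Phi is piecewise linear; its slope is comparable to 2^j between the breakpoints s_j and s_(j+1).
  The ratios s_(j+1)/s_j are huge except in blocks: a block of type k consists of k consecutive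
  ratios equal to 2^k, and every type occurs infinitely often. A bounded ratio at a large index
  forces a huge one boundedly many steps earlier, so every limit of Phi(s t)/Phi(s) is linear up
  to a constant. This constant depends on the block type, but any disjoint normalised sequence
  only needs one constant on a positive fraction of its mass, which gives an l1 subsequence.
  For the conjugate, Psi(2^j) is comparable to 2^j s_j. A huge ratio makes Psi(u/2)/Psi(u) tend
  to 0 and yields a c0-like sequence. Summing disjoint steps of all block types with weights
  2^(-k-1) yields a sequence whose n-fold sums are unbounded for every subsequence, because at
  each scale 2^k some block type contributes a fixed amount.
*)
theory Submission
  imports Defs
begin

section \<open>Disjoint sequences in Orlicz spaces\<close>

lemma sets_lebesgue_nonzero:
  fixes x :: "real \<Rightarrow> real"
  assumes "x \<in> borel_measurable lebesgue"
  shows "{t\<in>{0..1}. x t \<noteq> 0} \<in> sets lebesgue"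
proof -
  have "{t\<in>{0..1}. x t \<noteq> 0} = {0..1} \<inter> (x -` (- {0}) \<inter> space lebesgue)" by auto
  also have "\<dots> \<in> sets lebesgue"
    by (intro sets.Int measurable_sets[OF assms]) auto
  finally show ?thesis .
qed

section \<open>Monotonicity, scaling and measurability of Orlicz functions\<close>

lemma orlicz_function_mono:
  assumes "orlicz_function \<Phi>" "0 \<le> s" "s \<le> t"
  shows "\<Phi> s \<le> \<Phi> t"
  using assms by (auto simp: orlicz_function_def mono_on_def)

lemma orlicz_function_nonneg:
  assumes "orlicz_function \<Phi>" "0 \<le> s"
  shows "0 \<le> \<Phi> s"
  using orlicz_function_mono[OF assms(1), of 0 s] assms by (auto simp: orlicz_function_def)

lemma orlicz_function_scale:
  assumes "orlicz_function \<Phi>" "0 \<le> c" "c \<le> 1" "0 \<le> s"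
  shows "\<Phi> (c * s) \<le> c * \<Phi> s"
proof -
  have "\<Phi> ((1 - c) *\<^sub>R 0 + c *\<^sub>R s) \<le> (1 - c) * \<Phi> 0 + c * \<Phi> s"
    using assms by (intro convex_onD[of "{0..}"]) (auto simp: orlicz_function_def)
  then show ?thesis using assms by (simp add: orlicz_function_def)
qed

lemma orlicz_function_measurable:
  assumes "orlicz_function \<Phi>" "f \<in> borel_measurable M" "\<And>t. 0 \<le> f t"
  shows "(\<lambda>t. \<Phi> (f t)) \<in> borel_measurable M"
proof -
  \<comment> \<open>An Orlicz function is controlled only on [0,\<infinity>); precomposing with
    \<open>max 0\<close> gives a function monotone on the whole line, hence Borel.\<close>
  have "mono (\<lambda>s. \<Phi> (max 0 s))"
    by (intro monoI orlicz_function_mono[OF assms(1)]) auto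
  then have "(\<lambda>s. \<Phi> (max 0 s)) \<in> borel_measurable borel"
    by (rule borel_measurable_mono)
  from measurable_compose[OF assms(2) this] show ?thesis
    using assms(3) by (simp add: max_absorb2)
qed

lemma orlicz_integrand_measurable:
  fixes f :: "real \<Rightarrow> real"
  assumes "orlicz_function \<Phi>" "f \<in> borel_measurable lebesgue" "\<And>t. 0 \<le> f t"
  shows "(\<lambda>t. ennreal (\<Phi> (f t)) * indicator {0..1} t) \<in> borel_measurable lebesgue"
  by (intro borel_measurable_times_ennreal borel_measurable_indicator
      measurable_compose[OF orlicz_function_measurable[OF assms] measurable_ennreal]) simp

section \<open>The modular and the Luxemburg norm\<close>

lemma orlicz_mod_antimono:
  assumes "orlicz_function \<Phi>" "0 < l" "l \<le> l'"
  shows "orlicz_mod \<Phi> f l' \<le> orlicz_mod \<Phi> f l"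
  unfolding orlicz_mod_def
  using assms
  by (intro nn_integral_mono mult_right_mono ennreal_leI orlicz_function_mono[OF assms(1)]
      divide_left_mono) auto

lemma lux_norm_leI:
  assumes "0 < l" "orlicz_mod \<Phi> f l \<le> 1"
  shows "lux_norm \<Phi> f \<le> l"
  unfolding lux_norm_def
  using assms by (intro cInf_lower) (auto intro: bdd_belowI[of _ 0])

text \<open>Strict inequality avoids the question whether the infimum is attained: some admissible
  scale lies below \<open>l\<close>, and the modular is antitone in the scale.\<close>

lemma orlicz_mod_le_oneI:
  assumes "orlicz_function \<Phi>" "in_orlicz \<Phi> f" "lux_norm \<Phi> f < l"
  shows "orlicz_mod \<Phi> f l \<le> 1"
proof -
  obtain l' where "l' > 0" "orlicz_mod \<Phi> f l' \<le> 1" "l' < l"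
    using assms cInf_lessD[of "{l. l > 0 \<and> orlicz_mod \<Phi> f l \<le> 1}" l]
    unfolding lux_norm_def in_orlicz_def by blast
  then show ?thesis
    using orlicz_mod_antimono[OF assms(1), of l' l f] by simp
qed

text \<open>\<open>in_orlicz\<close> provides an admissible scale, so the infimum is not taken over
  the empty set.\<close>

lemma lux_norm_geI:
  assumes "in_orlicz \<Phi> f" "\<And>l. 0 < l \<Longrightarrow> orlicz_mod \<Phi> f l \<le> 1 \<Longrightarrow> c \<le> l"
  shows "c \<le> lux_norm \<Phi> f"
  unfolding lux_norm_def
  using assms by (intro cInf_greatest) (auto simp: in_orlicz_def)

section \<open>Modulars and norms of disjoint sums\<close>

lemma normalized_disjoint_compose:
  assumes "normalized_disjoint \<Phi> x" "strict_mono \<sigma>"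
  shows "normalized_disjoint \<Phi> (x \<circ> \<sigma>)"
  using assms strict_mono_eq[OF assms(2)]
  by (auto simp: normalized_disjoint_def pairwise_disjoint_seq_def)

text \<open>There are only countably many pairs of indices, so one null set absorbs all overlaps;
  afterwards disjointness can be used pointwise.\<close>

lemma pairwise_disjoint_seq_AE:
  assumes x: "\<And>n. x n \<in> borel_measurable lebesgue" and d: "pairwise_disjoint_seq x"
  shows "AE t in lebesgue. t \<in> {0..1} \<longrightarrow> (\<forall>n m. n \<noteq> m \<longrightarrow> x n t = 0 \<or> x m t = 0)"
proof -
  have "AE t in lebesgue. n \<noteq> m \<longrightarrow> t \<in> {0..1} \<longrightarrow> x n t = 0 \<or> x m t = 0" for n m
  proof (cases "n = m")
    case False
    have "{t\<in>{0..1}. x n t \<noteq> 0 \<and> x m t \<noteq> 0} = {t\<in>{0..1}. x n t \<noteq> 0} \<inter> {t\<in>{0..1}. x m t \<noteq> 0}"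
      by auto
    also have "\<dots> \<in> sets lebesgue"
      by (intro sets.Int sets_lebesgue_nonzero x)
    finally have "{t\<in>{0..1}. x n t \<noteq> 0 \<and> x m t \<noteq> 0} \<in> null_sets lebesgue"
      using d False unfolding pairwise_disjoint_seq_def by (blast intro: null_setsI)
    then show ?thesis
      by (rule AE_I') blast
  qed auto
  then have "AE t in lebesgue. \<forall>n m. n \<noteq> m \<longrightarrow> t \<in> {0..1} \<longrightarrow> x n t = 0 \<or> x m t = 0"
    by (simp add: AE_all_countable)
  then show ?thesis by eventually_elim auto
qed

text \<open>At most one summand is nonzero. The uses take for \<open>g\<close> first
  \<open>\<Phi>\<close> of the scaled modulus, then the test for being nonzero.\<close>

lemma sum_disjoint:
  fixes y :: "nat \<Rightarrow> 'a :: comm_monoid_add" and g :: "'a \<Rightarrow> 'b :: comm_monoid_add"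
  assumes "\<And>i j. i \<noteq> j \<Longrightarrow> y i = 0 \<or> y j = 0" "g 0 = 0"
  shows "g (\<Sum>i<n. y i) = (\<Sum>i<n. g (y i))"
proof (induction n)
  case (Suc n)
  show ?case
  proof (cases "y n = 0")
    case False
    then have "\<forall>i<n. y i = 0"
      using assms(1) by (metis less_irrefl)
    then show ?thesis
      using assms(2) by simp
  qed (use Suc assms in simp)
qed (use assms in simp)

lemma orlicz_mod_lin_comb:
  assumes \<Phi>: "orlicz_function \<Phi>" and x: "\<And>n. x n \<in> borel_measurable lebesgue"
    and d: "pairwise_disjoint_seq x" and "0 < l"
  shows "orlicz_mod \<Phi> (lin_comb a x n) l
    = (\<Sum>i<n. \<integral>\<^sup>+ t\<in>{0..1}. ennreal (\<Phi> (\<bar>a i\<bar> / l * \<bar>x i t\<bar>)) \<partial>lebesgue)"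
proof -
  have \<Phi>0: "\<Phi> 0 = 0" using \<Phi> by (simp add: orlicz_function_def)
  have "orlicz_mod \<Phi> (lin_comb a x n) l
      = (\<integral>\<^sup>+ t. (\<Sum>i<n. ennreal (\<Phi> (\<bar>a i\<bar> / l * \<bar>x i t\<bar>)) * indicator {0..1} t) \<partial>lebesgue)"
    unfolding orlicz_mod_def lin_comb_def
  proof (rule nn_integral_cong_AE)
    show "AE t in lebesgue. ennreal (\<Phi> (\<bar>\<Sum>i<n. a i * x i t\<bar> / l)) * indicator {0..1} t
        = (\<Sum>i<n. ennreal (\<Phi> (\<bar>a i\<bar> / l * \<bar>x i t\<bar>)) * indicator {0..1} t)"
      using pairwise_disjoint_seq_AE[OF x d]
    proof eventually_elim
      case (elim t)
      show ?case
      proof (cases "t \<in> {0..1}")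
        case True
        then have "a i * x i t = 0 \<or> a j * x j t = 0" if "i \<noteq> j" for i j
          using elim that by auto
        then have "ennreal (\<Phi> (\<bar>\<Sum>i<n. a i * x i t\<bar> / l)) = (\<Sum>i<n. ennreal (\<Phi> (\<bar>a i * x i t\<bar> / l)))"
          using \<Phi>0 by (intro sum_disjoint[where g="\<lambda>s. ennreal (\<Phi> (\<bar>s\<bar> / l))"]) auto
        then show ?thesis
          using True by (simp add: abs_mult)
      qed auto
    qed
  qed
  also have "\<dots> = (\<Sum>i<n. \<integral>\<^sup>+ t\<in>{0..1}. ennreal (\<Phi> (\<bar>a i\<bar> / l * \<bar>x i t\<bar>)) \<partial>lebesgue)"
  proof (rule nn_integral_sum)
    fix i
    show "(\<lambda>t. ennreal (\<Phi> (\<bar>a i\<bar> / l * \<bar>x i t\<bar>)) * indicator {0..1} t) \<in> borel_measurable lebesgue"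
      using x \<open>0 < l\<close> by (intro orlicz_integrand_measurable[OF \<Phi>]) auto
  qed
  finally show ?thesis .
qed

text \<open>Convexity pulls the factor \<open>2 * \<bar>a i\<bar> / l\<close>, at most 1, out of
  \<open>\<Phi>\<close>. The 2 is a scale strictly above the norm 1 of \<open>x i\<close>, where its
  modular is at most 1.\<close>

lemma orlicz_mod_lin_comb_le_one:
  assumes \<Phi>: "orlicz_function \<Phi>" and x: "normalized_disjoint \<Phi> x"
    and l: "0 < l" "2 * (\<Sum>i<n. \<bar>a i\<bar>) \<le> l"
  shows "orlicz_mod \<Phi> (lin_comb a x n) l \<le> 1"
proof -
  have xm: "x i \<in> borel_measurable lebesgue" and x1: "orlicz_mod \<Phi> (x i) 2 \<le> 1" for i
    using x orlicz_mod_le_oneI[OF \<Phi>, of "x i" 2]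
    by (auto simp: normalized_disjoint_def in_orlicz_def)
  have "(\<integral>\<^sup>+ t\<in>{0..1}. ennreal (\<Phi> (\<bar>a i\<bar> / l * \<bar>x i t\<bar>)) \<partial>lebesgue) \<le> ennreal (2 * \<bar>a i\<bar> / l)"
    if "i < n" for i
  proof -
    have "\<bar>a i\<bar> \<le> (\<Sum>i<n. \<bar>a i\<bar>)"
      using that by (intro member_le_sum) auto
    then have le: "2 * \<bar>a i\<bar> / l \<le> 1" using l by (simp add: field_simps)
    have p: "\<Phi> (\<bar>a i\<bar> / l * \<bar>x i t\<bar>) \<le> (2 * \<bar>a i\<bar> / l) * \<Phi> (\<bar>x i t\<bar> / 2)" for t
      using orlicz_function_scale[OF \<Phi>, of "2 * \<bar>a i\<bar> / l" "\<bar>x i t\<bar> / 2"] le l by simp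
    have "(\<integral>\<^sup>+ t\<in>{0..1}. ennreal (\<Phi> (\<bar>a i\<bar> / l * \<bar>x i t\<bar>)) \<partial>lebesgue)
      \<le> (\<integral>\<^sup>+ t. ennreal (2 * \<bar>a i\<bar> / l) * (ennreal (\<Phi> (\<bar>x i t\<bar> / 2)) * indicator {0..1} t) \<partial>lebesgue)"
      using l p orlicz_function_nonneg[OF \<Phi>]
      by (intro nn_integral_mono) (auto simp: ennreal_mult[symmetric] indicator_def intro!: ennreal_leI)
    also have "\<dots> = ennreal (2 * \<bar>a i\<bar> / l) * orlicz_mod \<Phi> (x i) 2"
      unfolding orlicz_mod_def
      using xm by (intro nn_integral_cmult orlicz_integrand_measurable[OF \<Phi>]) auto
    also have "\<dots> \<le> ennreal (2 * \<bar>a i\<bar> / l) * 1"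
      by (intro mult_left_mono x1) auto
    finally show ?thesis by simp
  qed
  then have "orlicz_mod \<Phi> (lin_comb a x n) l \<le> (\<Sum>i<n. ennreal (2 * \<bar>a i\<bar> / l))"
    unfolding orlicz_mod_lin_comb[OF \<Phi> xm x[unfolded normalized_disjoint_def, THEN conjunct2] l(1)]
    by (intro sum_mono) auto
  also have "\<dots> = ennreal (\<Sum>i<n. 2 * \<bar>a i\<bar> / l)"
    using l by (intro sum_ennreal) auto
  also have "(\<Sum>i<n. 2 * \<bar>a i\<bar> / l) = 2 * (\<Sum>i<n. \<bar>a i\<bar>) / l"
    by (simp add: sum_divide_distrib sum_distrib_left)
  also have "ennreal \<dots> \<le> 1" using l by simp
  finally show ?thesis .
qed

lemma in_orlicz_lin_comb:
  assumes \<Phi>: "orlicz_function \<Phi>" and x: "normalized_disjoint \<Phi> x"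
  shows "in_orlicz \<Phi> (lin_comb a x n)"
proof -
  have "0 < 2 * (\<Sum>i<n. \<bar>a i\<bar>) + 1" by (simp add: add_nonneg_pos sum_nonneg)
  moreover have "lin_comb a x n \<in> borel_measurable lebesgue"
    using x unfolding lin_comb_def normalized_disjoint_def in_orlicz_def
    by (intro borel_measurable_sum borel_measurable_times) auto
  ultimately show ?thesis
    using orlicz_mod_lin_comb_le_one[OF \<Phi> x, of "2 * (\<Sum>i<n. \<bar>a i\<bar>) + 1" a n]
    unfolding in_orlicz_def
    by (intro conjI exI[of _ "2 * (\<Sum>i<n. \<bar>a i\<bar>) + 1"]) linarith+
qed

lemma lux_norm_lin_comb_le:
  assumes \<Phi>: "orlicz_function \<Phi>" and x: "normalized_disjoint \<Phi> x"
  shows "lux_norm \<Phi> (lin_comb a x n) \<le> 2 * (\<Sum>i<n. \<bar>a i\<bar>)"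
proof (rule field_le_epsilon)
  fix e :: real assume "0 < e"
  moreover have "0 \<le> (\<Sum>i<n. \<bar>a i\<bar>)" by (simp add: sum_nonneg)
  ultimately have "0 < 2 * (\<Sum>i<n. \<bar>a i\<bar>) + e" by linarith
  then show "lux_norm \<Phi> (lin_comb a x n) \<le> 2 * (\<Sum>i<n. \<bar>a i\<bar>) + e"
    using \<open>0 < e\<close> by (intro lux_norm_leI orlicz_mod_lin_comb_le_one[OF \<Phi> x]) auto
qed

text \<open>Almost disjoint subsets of [0,1] have total measure at most 1, so the measures form a
  summable sequence.\<close>

lemma disjoint_supports_tendsto_0:
  assumes x: "\<And>n. x n \<in> borel_measurable lebesgue" and d: "pairwise_disjoint_seq x"
  shows "(\<lambda>n. measure lebesgue {t\<in>{0..1}. x n t \<noteq> 0}) \<longlonglongrightarrow> 0"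
proof -
  define S where "S n = {t\<in>{0..1}. x n t \<noteq> 0}" for n
  have S: "S n \<in> sets lebesgue" for n
    unfolding S_def by (rule sets_lebesgue_nonzero[OF x])
  have fin: "emeasure lebesgue (S n) = ennreal (measure lebesgue (S n))" for n
  proof (rule emeasure_eq_ennreal_measure)
    have "emeasure lebesgue (S n) \<le> emeasure lebesgue {0..1::real}"
      by (intro emeasure_mono) (auto simp: S_def)
    then show "emeasure lebesgue (S n) \<noteq> top" by (auto simp: top_unique)
  qed
  have "(\<Sum>i<n. measure lebesgue (S i)) \<le> 1" for n
  proof -
    have "ennreal (\<Sum>i<n. measure lebesgue (S i)) = (\<Sum>i<n. emeasure lebesgue (S i))"
      unfolding fin by (rule sum_ennreal[symmetric]) auto
    also have "\<dots> = (\<integral>\<^sup>+ t. (\<Sum>i<n. indicator (S i) t) \<partial>lebesgue)"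
      using S by (subst nn_integral_sum) auto
    also have "\<dots> \<le> (\<integral>\<^sup>+ t. indicator {0..1::real} t \<partial>lebesgue)"
    proof (rule nn_integral_mono_AE)
      show "AE t in lebesgue. (\<Sum>i<n. indicator (S i) t) \<le> (indicator {0..1} t :: ennreal)"
        using pairwise_disjoint_seq_AE[OF x d]
      proof eventually_elim
        case (elim t)
        show ?case
        proof (cases "t \<in> {0..1}")
          case True
          then have "(if (\<Sum>i<n. x i t) = 0 then 0 else 1 :: ennreal) = (\<Sum>i<n. if x i t = 0 then 0 else 1)"
            using elim by (intro sum_disjoint[where g="\<lambda>s. if s = 0 then 0 else 1"]) auto
          also have "\<dots> = (\<Sum>i<n. indicator (S i) t)"
            using True by (intro sum.cong) (auto simp: S_def indicator_def)
          finally have "(\<Sum>i<n. indicator (S i) t) = (if (\<Sum>i<n. x i t) = 0 then 0 else 1 :: ennreal)" ..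
          then show ?thesis using True by auto
        qed (auto simp: S_def)
      qed
    qed
    also have "\<dots> = 1" by simp
    finally show ?thesis by simp
  qed
  then have "summable (\<lambda>n. measure lebesgue (S n))"
    by (intro summableI_nonneg_bounded) auto
  then show ?thesis unfolding S_def by (rule summable_LIMSEQ_zero)
qed

section \<open>A criterion for the 1-DH property\<close>

text \<open>For \<open>\<tau> \<ge> \<epsilon>\<close>, convexity carries the lower bound from
  \<open>\<epsilon> * g t\<close> up to \<open>\<tau> * g t\<close> wherever the test in
  \<open>v\<close> holds. For smaller \<open>\<tau>\<close> the left side is at most 0 before
  \<open>ennreal\<close> truncates it; this is what the error \<open>\<epsilon>\<close> pays
  for.\<close>

lemma orlicz_function_integral_ge_linear:
  fixes g :: "real \<Rightarrow> real"
  assumes \<Phi>: "orlicz_function \<Phi>" and g: "g \<in> borel_measurable lebesgue" "\<And>t. 0 \<le> g t"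
    and c: "0 < c" "c \<le> 1" "0 < \<epsilon>" "0 \<le> \<tau>"
    and v: "ennreal (1/4) \<le> (\<integral>\<^sup>+ t\<in>{0..1}. ennreal (if c * \<epsilon> * \<Phi> (g t) \<le> \<Phi> (\<epsilon> * g t) then \<Phi> (g t) else 0) \<partial>lebesgue)"
  shows "ennreal (c * \<tau> / 4 - \<epsilon>) \<le> (\<integral>\<^sup>+ t\<in>{0..1}. ennreal (\<Phi> (\<tau> * g t)) \<partial>lebesgue)"
proof (cases "\<tau> < \<epsilon>")
  case True
  have "c * \<tau> \<le> 1 * \<tau>" using c by (intro mult_right_mono) auto
  then have "c * \<tau> / 4 - \<epsilon> \<le> 0" using True c by simp
  then show ?thesis by (simp add: ennreal_neg)
next
  case False
  have [measurable]: "(\<lambda>t. \<Phi> (g t)) \<in> borel_measurable lebesgue"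
    "(\<lambda>t. \<Phi> (\<epsilon> * g t)) \<in> borel_measurable lebesgue"
    using g c by (auto intro!: orlicz_function_measurable[OF \<Phi>])
  have m: "(\<lambda>t. ennreal (if c * \<epsilon> * \<Phi> (g t) \<le> \<Phi> (\<epsilon> * g t) then \<Phi> (g t) else 0) * indicator {0..1} t)
      \<in> borel_measurable lebesgue"
    by (intro borel_measurable_times_ennreal borel_measurable_indicator) (measurable, simp)
  have p: "c * \<tau> * (if c * \<epsilon> * \<Phi> (g t) \<le> \<Phi> (\<epsilon> * g t) then \<Phi> (g t) else 0) \<le> \<Phi> (\<tau> * g t)" for t
  proof (cases "c * \<epsilon> * \<Phi> (g t) \<le> \<Phi> (\<epsilon> * g t)")
    case True
    have "\<Phi> (\<epsilon> / \<tau> * (\<tau> * g t)) \<le> \<epsilon> / \<tau> * \<Phi> (\<tau> * g t)"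
      using c g False by (intro orlicz_function_scale[OF \<Phi>]) (auto simp: field_simps)
    then have "\<Phi> (\<epsilon> * g t) \<le> \<epsilon> / \<tau> * \<Phi> (\<tau> * g t)"
      using c False by simp
    with True have "c * \<epsilon> * \<Phi> (g t) \<le> \<epsilon> / \<tau> * \<Phi> (\<tau> * g t)" by simp
    then show ?thesis using True c False by (simp add: field_simps)
  qed (use c g orlicz_function_nonneg[OF \<Phi>] in auto)
  have "ennreal (c * \<tau> / 4 - \<epsilon>) \<le> ennreal (c * \<tau>) * ennreal (1/4)"
    using c by (subst ennreal_mult[symmetric]) (auto intro!: ennreal_leI)
  also have "\<dots> \<le> ennreal (c * \<tau>) * (\<integral>\<^sup>+ t\<in>{0..1}. ennreal (if c * \<epsilon> * \<Phi> (g t) \<le> \<Phi> (\<epsilon> * g t) then \<Phi> (g t) else 0) \<partial>lebesgue)"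
    by (intro mult_left_mono v) auto
  also have "\<dots> = (\<integral>\<^sup>+ t. ennreal (c * \<tau>) * (ennreal (if c * \<epsilon> * \<Phi> (g t) \<le> \<Phi> (\<epsilon> * g t) then \<Phi> (g t) else 0)
      * indicator {0..1} t) \<partial>lebesgue)"
    by (rule nn_integral_cmult[OF m, symmetric])
  also have "\<dots> \<le> (\<integral>\<^sup>+ t\<in>{0..1}. ennreal (\<Phi> (\<tau> * g t)) \<partial>lebesgue)"
  proof (intro nn_integral_mono)
    fix t
    have "ennreal (c * \<tau>) * ennreal (if c * \<epsilon> * \<Phi> (g t) \<le> \<Phi> (\<epsilon> * g t) then \<Phi> (g t) else 0)
        \<le> ennreal (\<Phi> (\<tau> * g t))"
      using p[of t] c g orlicz_function_nonneg[OF \<Phi>]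
      by (subst ennreal_mult[symmetric]) (auto intro!: ennreal_leI)
    then show "ennreal (c * \<tau>) * (ennreal (if c * \<epsilon> * \<Phi> (g t) \<le> \<Phi> (\<epsilon> * g t) then \<Phi> (g t) else 0)
      * indicator {0..1} t) \<le> ennreal (\<Phi> (\<tau> * g t)) * indicator {0..1} t"
      by (simp add: mult.assoc[symmetric] mult_right_mono)
  qed
  finally show ?thesis .
qed

text \<open>Each property holds at arbitrarily large indices, so the next index can be picked beyond
  the previous one. The property varies with the position, which lets tolerances shrink along the
  subsequence.\<close>

lemma strict_mono_choice:
  fixes P :: "nat \<Rightarrow> nat \<Rightarrow> bool"
  assumes "\<And>k. \<exists>\<^sub>\<infinity>i. P k i"
  obtains \<sigma> where "strict_mono \<sigma>" "\<And>k. P k (\<sigma> k)"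
proof -
  have "\<exists>\<sigma>. \<forall>k. P k (\<sigma> k) \<and> \<sigma> k < \<sigma> (Suc k)"
    using assms by (intro dependent_nat_choice) (auto simp: INFM_nat)
  then show ?thesis
    using that by (auto simp: strict_mono_Suc_iff)
qed

text \<open>With \<open>c\<close> fixed, a quarter of the modular of \<open>2 x\<^sub>i\<close> sits, for every \<open>\<epsilon>\<close> and infinitely many \<open>i\<close>, where
  \<open>\<Phi>\<close> is linear up to the factor \<open>c\<close> on the whole range from \<open>\<epsilon> s\<close> to \<open>s\<close>. Either \<open>c0\<close> does this for
  all \<open>\<epsilon>\<close>, or it fails at some \<open>\<epsilon>0\<close>; then most of the mass lies outside the first alternative of the
  assumption at \<open>\<epsilon>0\<close>, hence in the second one. Small values are negligible because the supports
  shrink.\<close>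

lemma normalized_disjoint_mass:
  assumes \<Phi>: "orlicz_function \<Phi>" and "0 < c0"
    and P: "\<And>\<epsilon>0. 0 < \<epsilon>0 \<Longrightarrow> \<exists>c>0. \<forall>\<epsilon>>0. \<exists>S. \<forall>s\<ge>S.
      c0 * \<epsilon>0 * \<Phi> s \<le> \<Phi> (\<epsilon>0 * s) \<or> c * \<epsilon> * \<Phi> s \<le> \<Phi> (\<epsilon> * s)"
    and x: "normalized_disjoint \<Phi> x"
  obtains c where "0 < c" "c \<le> 1" "\<And>\<epsilon>. 0 < \<epsilon> \<Longrightarrow> \<exists>\<^sub>\<infinity>i. ennreal (1/4) \<le>
    (\<integral>\<^sup>+ t\<in>{0..1}. ennreal (if c * \<epsilon> * \<Phi> (2 * \<bar>x i t\<bar>) \<le> \<Phi> (\<epsilon> * (2 * \<bar>x i t\<bar>)) then \<Phi> (2 * \<bar>x i t\<bar>) else 0) \<partial>lebesgue)"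
proof -
  define g where "g i t = 2 * \<bar>x i t\<bar>" for i t
  define V where "V i c \<epsilon> = (\<integral>\<^sup>+ t\<in>{0..1}. ennreal (if c * \<epsilon> * \<Phi> (g i t) \<le> \<Phi> (\<epsilon> * g i t) then \<Phi> (g i t) else 0) \<partial>lebesgue)"
    for i c \<epsilon>
  have \<Phi>0: "\<Phi> 0 = 0" using \<Phi> by (simp add: orlicz_function_def)
  have xm: "x i \<in> borel_measurable lebesgue" for i
    using x by (auto simp: normalized_disjoint_def in_orlicz_def)
  have gm: "g i \<in> borel_measurable lebesgue" for i
    unfolding g_def using xm by auto
  have g0: "0 \<le> g i t" for i t by (simp add: g_def)
  note nn = orlicz_function_nonneg[OF \<Phi>]
  have Vmono: "V i c \<epsilon> \<le> V i c' \<epsilon>" if "c' \<le> c" "0 < \<epsilon>" for i c c' \<epsilon>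
    unfolding V_def
  proof (intro nn_integral_mono mult_right_mono ennreal_leI)
    fix t
    have "c' * (\<epsilon> * \<Phi> (g i t)) \<le> c * (\<epsilon> * \<Phi> (g i t))"
      using that g0 nn by (intro mult_right_mono) auto
    then show "(if c * \<epsilon> * \<Phi> (g i t) \<le> \<Phi> (\<epsilon> * g i t) then \<Phi> (g i t) else 0)
      \<le> (if c' * \<epsilon> * \<Phi> (g i t) \<le> \<Phi> (\<epsilon> * g i t) then \<Phi> (g i t) else 0)"
      using g0 nn by (auto simp: mult.assoc)
  qed auto
  have "\<exists>c>0. c \<le> 1 \<and> (\<forall>\<epsilon>>0. \<exists>\<^sub>\<infinity>i. ennreal (1/4) \<le> V i c \<epsilon>)"
  proof (cases "\<forall>\<epsilon>>0. \<exists>\<^sub>\<infinity>i. ennreal (1/4) \<le> V i c0 \<epsilon>")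
    \<comment> \<open>Here \<open>c0\<close> itself works; capping it at 1 only enlarges the set
      tested in \<open>V\<close>.\<close>
    case True
    have "\<exists>\<^sub>\<infinity>i. ennreal (1/4) \<le> V i (min c0 1) \<epsilon>" if "0 < \<epsilon>" for \<epsilon>
      using True[rule_format, OF that]
      by (rule frequently_elim1) (use Vmono[of "min c0 1" c0, OF _ that] order_trans in auto)
    then show ?thesis using \<open>0 < c0\<close> by (intro exI[of _ "min c0 1"]) auto
  next
    case False
    then obtain \<epsilon>0 where \<epsilon>0: "0 < \<epsilon>0" and "\<not> (\<exists>\<^sub>\<infinity>i. ennreal (1/4) \<le> V i c0 \<epsilon>0)"
      by blast
    then have ev0: "\<forall>\<^sub>\<infinity>i. V i c0 \<epsilon>0 < ennreal (1/4)"
      by (simp only: not_frequently not_le)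
    obtain c where "0 < c" and c: "\<forall>\<epsilon>>0. \<exists>S. \<forall>s\<ge>S. c0 * \<epsilon>0 * \<Phi> s \<le> \<Phi> (\<epsilon>0 * s) \<or> c * \<epsilon> * \<Phi> s \<le> \<Phi> (\<epsilon> * s)"
      using P[OF \<epsilon>0] by blast
    have "\<exists>\<^sub>\<infinity>i. ennreal (1/4) \<le> V i (min c 1) \<epsilon>" if "0 < \<epsilon>" for \<epsilon>
    proof -
      obtain S0 where S0: "\<And>s. s \<ge> S0 \<Longrightarrow> c0 * \<epsilon>0 * \<Phi> s \<le> \<Phi> (\<epsilon>0 * s) \<or> c * \<epsilon> * \<Phi> s \<le> \<Phi> (\<epsilon> * s)"
        using c \<open>0 < \<epsilon>\<close> by blast
      define S where "S = max S0 0"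
      have "(\<lambda>i. \<Phi> S * measure lebesgue {t\<in>{0..1}. x i t \<noteq> 0}) \<longlonglongrightarrow> \<Phi> S * 0"
        using x unfolding normalized_disjoint_def
        by (intro tendsto_mult_left disjoint_supports_tendsto_0 xm) auto
      then have "\<forall>\<^sub>F i in sequentially. \<Phi> S * measure lebesgue {t\<in>{0..1}. x i t \<noteq> 0} < 1/4"
        by (intro order_tendstoD(2)[of _ 0]) simp_all
      then have "\<forall>\<^sub>F i in sequentially. ennreal (1/4) \<le> V i (min c 1) \<epsilon>"
        using ev0[unfolded cofinite_eq_sequentially]
      proof eventually_elim
        case (elim i)
        define N where "N = {t\<in>{0..1}. x i t \<noteq> 0}"
        have N: "N \<in> sets lebesgue" unfolding N_def by (rule sets_lebesgue_nonzero[OF xm])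
        have "emeasure lebesgue N \<le> emeasure lebesgue {0..1::real}"
          by (intro emeasure_mono) (auto simp: N_def)
        then have eN: "emeasure lebesgue N = ennreal (measure lebesgue N)"
          by (intro emeasure_eq_ennreal_measure) (auto simp: top_unique)
        have [measurable]: "(\<lambda>t. \<Phi> (g i t)) \<in> borel_measurable lebesgue"
          "(\<lambda>t. \<Phi> (\<epsilon> * g i t)) \<in> borel_measurable lebesgue"
          "(\<lambda>t. \<Phi> (\<epsilon>0 * g i t)) \<in> borel_measurable lebesgue"
          using gm g0 \<open>0 < \<epsilon>\<close> \<epsilon>0 by (auto intro!: orlicz_function_measurable[OF \<Phi>])
        have m: "(\<lambda>t. ennreal (if c * \<epsilon> * \<Phi> (g i t) \<le> \<Phi> (\<epsilon> * g i t) then \<Phi> (g i t) else 0) * indicator {0..1} t) \<in> borel_measurable lebesgue"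
          "(\<lambda>t. ennreal (if c0 * \<epsilon>0 * \<Phi> (g i t) \<le> \<Phi> (\<epsilon>0 * g i t) then \<Phi> (g i t) else 0) * indicator {0..1} t) \<in> borel_measurable lebesgue"
          by (intro borel_measurable_times_ennreal borel_measurable_indicator; measurable; simp)+
        have Nm: "(\<lambda>t. ennreal (\<Phi> S) * indicator N t) \<in> borel_measurable lebesgue"
          using N by (intro borel_measurable_times_ennreal borel_measurable_indicator) auto
        \<comment> \<open>Above \<open>S\<close> one of the two tests holds; below \<open>S\<close>
          the value is at most \<open>\<Phi> S\<close>, and it vanishes off the support
          \<open>N\<close>.\<close>
        have p: "ennreal (\<Phi> (g i t)) \<le> ennreal (if c0 * \<epsilon>0 * \<Phi> (g i t) \<le> \<Phi> (\<epsilon>0 * g i t) then \<Phi> (g i t) else 0)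
            + (ennreal (if c * \<epsilon> * \<Phi> (g i t) \<le> \<Phi> (\<epsilon> * g i t) then \<Phi> (g i t) else 0) + ennreal (\<Phi> S) * indicator N t)"
          if "t \<in> {0..1}" for t
        proof (cases "g i t \<ge> S")
          case True
          then show ?thesis using S0[of "g i t"] by (auto simp: S_def)
        next
          case False
          show ?thesis
          proof (cases "x i t = 0")
            case x0: False
            then have "t \<in> N" using that by (simp add: N_def)
            moreover have "ennreal (\<Phi> (g i t)) \<le> ennreal (\<Phi> S)"
              using False g0 by (intro ennreal_leI orlicz_function_mono[OF \<Phi>]) auto
            ultimately show ?thesis by (auto intro: add_increasing)
          qed (simp add: g_def \<Phi>0)
        qed
        \<comment> \<open>The norm 1 exceeds 1/2, so 1/2 is not an admissible scale; this is the
          reason for the 2 in \<open>g\<close>.\<close>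
        have "1 \<le> (\<integral>\<^sup>+ t\<in>{0..1}. ennreal (\<Phi> (g i t)) \<partial>lebesgue)"
        proof (rule ccontr)
          assume "\<not> ?thesis"
          then have "orlicz_mod \<Phi> (x i) (1/2) \<le> 1"
            by (simp add: orlicz_mod_def g_def mult.commute)
          from lux_norm_leI[OF _ this] x show False
            by (auto simp: normalized_disjoint_def)
        qed
        also have "\<dots> \<le> (\<integral>\<^sup>+ t. ennreal (if c0 * \<epsilon>0 * \<Phi> (g i t) \<le> \<Phi> (\<epsilon>0 * g i t) then \<Phi> (g i t) else 0) * indicator {0..1} t
            + (ennreal (if c * \<epsilon> * \<Phi> (g i t) \<le> \<Phi> (\<epsilon> * g i t) then \<Phi> (g i t) else 0) * indicator {0..1} t
               + ennreal (\<Phi> S) * indicator N t) \<partial>lebesgue)"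
        proof (rule nn_integral_mono)
          fix t :: real
          show "ennreal (\<Phi> (g i t)) * indicator {0..1} t \<le> ennreal (if c0 * \<epsilon>0 * \<Phi> (g i t) \<le> \<Phi> (\<epsilon>0 * g i t) then \<Phi> (g i t) else 0) * indicator {0..1} t
            + (ennreal (if c * \<epsilon> * \<Phi> (g i t) \<le> \<Phi> (\<epsilon> * g i t) then \<Phi> (g i t) else 0) * indicator {0..1} t
               + ennreal (\<Phi> S) * indicator N t)"
          proof (cases "t \<in> {0..1}")
            case True
            from p[OF this] show ?thesis by (simp only: indicator_simps(1)[OF True] mult_1_right)
          next
            case False
            show ?thesis by (simp only: indicator_simps(2)[OF False] mult_zero_right zero_le)
          qed
        qed
        also have "\<dots> = V i c0 \<epsilon>0 + (V i c \<epsilon> + ennreal (\<Phi> S) * emeasure lebesgue N)"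
          unfolding V_def nn_integral_add[OF m(2) borel_measurable_add[OF m(1) Nm]]
            nn_integral_add[OF m(1) Nm] nn_integral_cmult_indicator[OF N] ..
        \<comment> \<open>Two of the three terms take at most 1/4 each, so a total of at least 1
          leaves more than enough for \<open>V i c \<epsilon>\<close>.\<close>
        also have "\<dots> \<le> ennreal (1/4) + (V i c \<epsilon> + ennreal (1/4))"
        proof (intro add_mono order_refl)
          show "V i c0 \<epsilon>0 \<le> ennreal (1/4)" using elim by simp
          show "ennreal (\<Phi> S) * emeasure lebesgue N \<le> ennreal (1/4)"
            using elim(1) nn[of S] unfolding eN N_def[symmetric]
            by (subst ennreal_mult[symmetric]) (auto simp: S_def intro!: ennreal_leI)
        qed
        also have "\<dots> = V i c \<epsilon> + ennreal (1/2)"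
          by (simp only: add.left_commute[of _ "V i c \<epsilon>"], subst ennreal_plus[symmetric]) simp_all
        finally have *: "1 \<le> V i c \<epsilon> + ennreal (1/2)" .
        have "ennreal (1/4) \<le> V i c \<epsilon>"
        proof (rule ccontr)
          assume "\<not> ?thesis"
          then have "V i c \<epsilon> + ennreal (1/2) \<le> ennreal (1/4) + ennreal (1/2)"
            by (intro add_right_mono) simp
          also have "\<dots> = ennreal (3/4)" by (subst ennreal_plus[symmetric]) simp_all
          also have "\<dots> < 1" by (subst ennreal_1[symmetric], subst ennreal_less_iff) simp_all
          finally show False using * by simp
        qed
        also have "\<dots> \<le> V i (min c 1) \<epsilon>" using \<open>0 < \<epsilon>\<close> by (intro Vmono) auto
        finally show ?case .
      qed
      then show ?thesis
        unfolding cofinite_eq_sequentially by (rule eventually_frequently[rotated]) simp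
    qed
    then show ?thesis using \<open>0 < c\<close> by (intro exI[of _ "min c 1"]) auto
  qed
  then show ?thesis
    using that unfolding V_def g_def by blast
qed

text \<open>The constant \<open>c\<close> may depend on \<open>\<epsilon>0\<close> but serves every
  \<open>\<epsilon>\<close>, while \<open>c0\<close> is fixed beforehand; this suffices for one
  constant per sequence. Along \<open>\<sigma>\<close> the \<open>k\<close>-th element is good at
  \<open>(1/2)^k\<close>, so the errors in the lower l1 estimate are summable. The upper estimate is
  \<open>lux_norm_lin_comb_le\<close>.\<close>

lemma one_DH_criterion:
  assumes \<Phi>: "orlicz_function \<Phi>" and "0 < c0"
    and P: "\<And>\<epsilon>0. 0 < \<epsilon>0 \<Longrightarrow> \<exists>c>0. \<forall>\<epsilon>>0. \<exists>S. \<forall>s\<ge>S.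
      c0 * \<epsilon>0 * \<Phi> s \<le> \<Phi> (\<epsilon>0 * s) \<or> c * \<epsilon> * \<Phi> s \<le> \<Phi> (\<epsilon> * s)"
  shows "one_DH \<Phi>"
  unfolding one_DH_def
proof (intro allI impI)
  fix x assume x: "normalized_disjoint \<Phi> x"
  obtain c where c: "0 < c" "c \<le> 1" and
    inf: "\<And>\<epsilon>. 0 < \<epsilon> \<Longrightarrow> \<exists>\<^sub>\<infinity>i. ennreal (1/4) \<le>
    (\<integral>\<^sup>+ t\<in>{0..1}. ennreal (if c * \<epsilon> * \<Phi> (2 * \<bar>x i t\<bar>) \<le> \<Phi> (\<epsilon> * (2 * \<bar>x i t\<bar>)) then \<Phi> (2 * \<bar>x i t\<bar>) else 0) \<partial>lebesgue)"
    using normalized_disjoint_mass[OF assms x] by blast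
  define Q where "Q k i \<longleftrightarrow> ennreal (1/4) \<le>
    (\<integral>\<^sup>+ t\<in>{0..1}. ennreal (if c * (1/2)^k * \<Phi> (2 * \<bar>x i t\<bar>) \<le> \<Phi> ((1/2)^k * (2 * \<bar>x i t\<bar>))
      then \<Phi> (2 * \<bar>x i t\<bar>) else 0) \<partial>lebesgue)" for k i
  have "\<exists>\<^sub>\<infinity>i. Q k i" for k
    unfolding Q_def by (rule inf) simp
  then obtain \<sigma> where \<sigma>: "strict_mono \<sigma>" and mass: "\<And>k. Q k (\<sigma> k)"
    using strict_mono_choice[of Q] by blast
  define z where "z = x \<circ> \<sigma>"
  have z: "normalized_disjoint \<Phi> z"
    unfolding z_def by (rule normalized_disjoint_compose[OF x \<sigma>])
  then have zm: "z i \<in> borel_measurable lebesgue" for i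
    by (auto simp: normalized_disjoint_def in_orlicz_def)
  have low: "ennreal (c * \<tau> / 4 - (1/2)^i) \<le> (\<integral>\<^sup>+ t\<in>{0..1}. ennreal (\<Phi> (\<tau> * (2 * \<bar>z i t\<bar>))) \<partial>lebesgue)"
    if "0 \<le> \<tau>" for i \<tau>
    using mass[of i] zm that c unfolding z_def Q_def o_apply
    by (intro orlicz_function_integral_ge_linear[OF \<Phi>]) auto
  have "(\<Sum>i<n. \<bar>a i\<bar>) \<le> 24 / c * lux_norm \<Phi> (lin_comb a z n)" for a n
  proof -
    have "c / 24 * (\<Sum>i<n. \<bar>a i\<bar>) \<le> lux_norm \<Phi> (lin_comb a z n)"
    proof (rule lux_norm_geI[OF in_orlicz_lin_comb[OF \<Phi> z]])
      fix l :: real assume l: "0 < l" and le: "orlicz_mod \<Phi> (lin_comb a z n) l \<le> 1"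
      \<comment> \<open>\<open>low\<close> is used with
        \<open>\<tau> = \<bar>a i\<bar> / (2 * l)\<close>, the 2 cancelling the one before
        \<open>\<bar>z i t\<bar>\<close>; \<open>max 0\<close> mirrors the truncation by
        \<open>ennreal\<close>.\<close>
      have "ennreal (\<Sum>i<n. max 0 (c * (\<bar>a i\<bar> / (2 * l)) / 4 - (1/2)^i))
          = (\<Sum>i<n. ennreal (c * (\<bar>a i\<bar> / (2 * l)) / 4 - (1/2)^i))"
        by (subst sum_ennreal[symmetric], simp, intro sum.cong refl)
          (simp add: max_def ennreal_neg del: times_divide_eq_right)
      also have "\<dots> \<le> (\<Sum>i<n. \<integral>\<^sup>+ t\<in>{0..1}. ennreal (\<Phi> (\<bar>a i\<bar> / (2 * l) * (2 * \<bar>z i t\<bar>))) \<partial>lebesgue)"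
        using l by (intro sum_mono low) auto
      also have "\<dots> = orlicz_mod \<Phi> (lin_comb a z n) l"
        using z l by (subst orlicz_mod_lin_comb[OF \<Phi> zm]) (auto simp: normalized_disjoint_def)
      finally have "(\<Sum>i<n. max 0 (c * (\<bar>a i\<bar> / (2 * l)) / 4 - (1/2)^i)) \<le> 1"
        using le by (simp only: ennreal_le_1[symmetric] order_trans)
      moreover have "(\<Sum>i<n. c * (\<bar>a i\<bar> / (2 * l)) / 4 - (1/2)^i)
          \<le> (\<Sum>i<n. max 0 (c * (\<bar>a i\<bar> / (2 * l)) / 4 - (1/2)^i))"
        by (intro sum_mono) auto
      moreover have "(\<Sum>i<n. (1/2::real)^i) \<le> 2"
        by (subst geometric_sum) (simp_all add: field_simps)
      moreover have "(\<Sum>i<n. c * (\<bar>a i\<bar> / (2 * l)) / 4 - (1/2)^i)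
          = c / (8 * l) * (\<Sum>i<n. \<bar>a i\<bar>) - (\<Sum>i<n. (1/2::real)^i)"
        by (simp add: sum_subtractf sum_distrib_left)
      \<comment> \<open>The modular bound 1 plus errors of at most 2 give 3; multiplied by the 8
        this is the constant 24.\<close>
      ultimately have "c / (8 * l) * (\<Sum>i<n. \<bar>a i\<bar>) \<le> 3" by linarith
      then show "c / 24 * (\<Sum>i<n. \<bar>a i\<bar>) \<le> l" using l by (simp add: field_simps)
    qed
    then show ?thesis using c by (simp add: field_simps)
  qed
  moreover have "lux_norm \<Phi> (lin_comb a z n) \<le> 24 / c * (\<Sum>i<n. \<bar>a i\<bar>)" for a n
  proof -
    have "2 * (\<Sum>i<n. \<bar>a i\<bar>) \<le> 24 / c * (\<Sum>i<n. \<bar>a i\<bar>)"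
      using c by (intro mult_right_mono) (auto simp: field_simps intro: sum_nonneg)
    then show ?thesis using lux_norm_lin_comb_le[OF \<Phi> z, of a n] by linarith
  qed
  ultimately have "l1_equiv \<Phi> (x \<circ> \<sigma>)"
    using c unfolding l1_equiv_def z_def by (intro exI[of _ "24 / c"]) auto
  then show "\<exists>\<sigma>. strict_mono \<sigma> \<and> l1_equiv \<Phi> (x \<circ> \<sigma>)" using \<sigma> by blast
qed

section \<open>A criterion for the failure of the DH property\<close>

text \<open>The \<open>n\<close>-th function is the disjoint sum over \<open>k\<close> of steps of height \<open>u n k\<close>, the \<open>k\<close>-th step
  carrying modular \<open>2\<^sup>-\<^sup>k\<^sup>-\<^sup>1\<close>. The lower bound on \<open>\<Psi> (u n k)\<close> makes its support fit into the
  \<open>prod_encode (n, k)\<close>-th dyadic slot of [0,1].\<close>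

lemma ex_normalized_disjoint_steps:
  assumes \<Psi>: "orlicz_function \<Psi>" and u: "\<And>n k. 0 < u n k"
    "\<And>n k. 2 ^ (prod_encode (n, k) + 1) \<le> \<Psi> (u n k)"
  obtains z where "normalized_disjoint \<Psi> z"
    "\<And>n l. 0 < l \<Longrightarrow> orlicz_mod \<Psi> (z n) l = (\<Sum>k. ennreal ((1/2)^(k + 1) * \<Psi> (u n k / l) / \<Psi> (u n k)))"
proof -
  have \<Psi>0: "\<Psi> 0 = 0" using \<Psi> by (simp add: orlicz_function_def)
  note nn = orlicz_function_nonneg[OF \<Psi>]
  have \<Psi>pos: "0 < \<Psi> (u n k)" for n k
    by (rule less_le_trans[OF _ u(2)]) simp
  define w where "w n k = (1/2)^(k + 1) / \<Psi> (u n k)" for n k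
  define J :: "nat \<Rightarrow> nat \<Rightarrow> real set" where
    "J n k = {(1/2)^(prod_encode (n, k) + 1) ..< (1/2)^(prod_encode (n, k) + 1) + w n k}" for n k
  \<comment> \<open>At each point at most one term is nonzero, so the series converges; its form
    gives measurability directly.\<close>
  define z where "z n t = (\<Sum>k. u n k * indicator (J n k) t)" for n t
  have w0: "0 < w n k" for n k using \<Psi>pos by (simp add: w_def)
  have w_le: "w n k \<le> (1/2)^(prod_encode (n, k) + 1)" for n k
  proof -
    have "w n k \<le> 1 / \<Psi> (u n k)"
      unfolding w_def using \<Psi>pos[of n k] by (intro divide_right_mono) (auto simp: power_le_one simp del: power_Suc)
    also have "\<dots> \<le> 1 / 2 ^ (prod_encode (n, k) + 1)"
      using u(2)[of n k] \<Psi>pos[of n k] by (intro divide_left_mono) auto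
    finally show ?thesis by (simp add: power_one_over)
  qed
  have J_slot: "(1/2)^(prod_encode (n, k) + 1) \<le> t" "t < (1/2)^prod_encode (n, k)" if "t \<in> J n k" for n k t
    using that w_le[of n k] by (auto simp: J_def)
  have J_sub: "J n k \<subseteq> {0..1}" for n k
  proof
    fix t assume "t \<in> J n k"
    from J_slot[OF this] have "(1/2)^(prod_encode (n, k) + 1) \<le> t" "t < (1/2)^prod_encode (n, k)" by auto
    moreover have "(0::real) \<le> (1/2)^(prod_encode (n, k) + 1)" "(1/2::real)^prod_encode (n, k) \<le> 1"
      by (auto simp: power_le_one)
    ultimately show "t \<in> {0..1}" unfolding atLeastAtMost_iff by linarith
  qed
  have J_disj: "(n, k) = (n', k')" if "t \<in> J n k" "t \<in> J n' k'" for n k n' k' t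
  proof -
    have "\<not> prod_encode (n, k) < prod_encode (n', k')" if t: "t \<in> J n k" "t \<in> J n' k'" for n k n' k' t
    proof
      assume "prod_encode (n, k) < prod_encode (n', k')"
      then have "(1/2::real) ^ prod_encode (n', k') \<le> (1/2) ^ (prod_encode (n, k) + 1)"
        by (intro power_decreasing) auto
      then show False using J_slot[OF t(1)] J_slot[OF t(2)] by linarith
    qed
    from this[OF that] this[OF that(2) that(1)]
    show ?thesis using inj_prod_encode[of UNIV] by (metis injD linorder_neqE_nat)
  qed
  have z_in: "z n t = u n k" if "t \<in> J n k" for n k t
  proof -
    have "z n t = (\<Sum>j\<in>{k}. u n j * indicator (J n j) t)"
      unfolding z_def by (rule suminf_finite) (use that J_disj in \<open>auto simp: indicator_def\<close>)
    then show ?thesis using that by simp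
  qed
  have z_out: "z n t = 0" if "\<And>k. t \<notin> J n k" for n t
    unfolding z_def using that by (simp add: indicator_def)
  have J_meas: "J n k \<in> sets lebesgue" for n k by (simp add: J_def)
  have eJ: "emeasure lebesgue (J n k) = ennreal (w n k)" for n k
    using w0[of n k] by (simp add: J_def)
  have zm: "z n \<in> borel_measurable lebesgue" for n
    unfolding z_def using J_meas
    by (intro borel_measurable_suminf borel_measurable_times borel_measurable_indicator) auto
  have mod: "orlicz_mod \<Psi> (z n) l = (\<Sum>k. ennreal ((1/2)^(k + 1) * \<Psi> (u n k / l) / \<Psi> (u n k)))"
    if l: "0 < l" for n l
  proof -
    have "orlicz_mod \<Psi> (z n) l = (\<integral>\<^sup>+ t. (\<Sum>k. ennreal (\<Psi> (u n k / l)) * indicator (J n k) t) \<partial>lebesgue)"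
      unfolding orlicz_mod_def
    proof (rule nn_integral_cong)
      fix t
      show "ennreal (\<Psi> (\<bar>z n t\<bar> / l)) * indicator {0..1} t = (\<Sum>k. ennreal (\<Psi> (u n k / l)) * indicator (J n k) t)"
      proof (cases "\<exists>k. t \<in> J n k")
        case True
        then obtain k where k: "t \<in> J n k" by blast
        have "(\<Sum>k. ennreal (\<Psi> (u n k / l)) * indicator (J n k) t)
            = (\<Sum>j\<in>{k}. ennreal (\<Psi> (u n j / l)) * indicator (J n j) t)"
          by (rule suminf_finite) (use k J_disj in \<open>auto simp: indicator_def\<close>)
        then show ?thesis using k J_sub[of n k] z_in[OF k] u(1)[of n k] by (auto simp: indicator_def)
      next
        case False
        then show ?thesis using z_out[of t n] by (simp add: \<Psi>0)
      qed
    qed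
    also have "\<dots> = (\<Sum>k. \<integral>\<^sup>+ t. ennreal (\<Psi> (u n k / l)) * indicator (J n k) t \<partial>lebesgue)"
      using J_meas by (intro nn_integral_suminf borel_measurable_times_ennreal borel_measurable_indicator) auto
    also have "\<dots> = (\<Sum>k. ennreal ((1/2)^(k + 1) * \<Psi> (u n k / l) / \<Psi> (u n k)))"
    proof (rule arg_cong[where f=suminf], rule ext)
      fix k
      have "(\<integral>\<^sup>+ t. ennreal (\<Psi> (u n k / l)) * indicator (J n k) t \<partial>lebesgue)
          = ennreal (\<Psi> (u n k / l)) * ennreal (w n k)"
        unfolding nn_integral_cmult_indicator[OF J_meas] eJ ..
      also have "\<dots> = ennreal ((1/2)^(k + 1) * \<Psi> (u n k / l) / \<Psi> (u n k))"
        using nn[of "u n k / l"] w0[of n k] u(1)[of n k] l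
        by (subst ennreal_mult[symmetric]) (auto simp: w_def mult.commute)
      finally show "(\<integral>\<^sup>+ t. ennreal (\<Psi> (u n k / l)) * indicator (J n k) t \<partial>lebesgue)
          = ennreal ((1/2)^(k + 1) * \<Psi> (u n k / l) / \<Psi> (u n k))" .
    qed
    finally show ?thesis .
  qed
  have geom: "(\<Sum>k. ennreal (c * (1/2)^(k + 1))) = ennreal c" if "0 \<le> c" for c
  proof (rule suminf_ennreal_eq)
    show "(\<lambda>k. c * (1/2)^(k + 1)) sums c"
      using sums_mult[OF power_half_series, of c] by simp
  qed (use that in auto)
  have mod1: "orlicz_mod \<Psi> (z n) 1 = 1" for n
  proof -
    have "(1/2)^(k + 1) * \<Psi> (u n k / 1) / \<Psi> (u n k) = 1 * (1/2)^(k + 1)" for k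
      using \<Psi>pos[of n k] by simp
    then show ?thesis by (simp only: mod[OF zero_less_one] geom[OF zero_le_one] ennreal_1)
  qed
  have inz: "in_orlicz \<Psi> (z n)" for n
    unfolding in_orlicz_def using zm mod1[of n] by (intro conjI exI[of _ 1]) auto
  have "lux_norm \<Psi> (z n) = 1" for n
  proof (rule antisym)
    show "lux_norm \<Psi> (z n) \<le> 1" using mod1 by (intro lux_norm_leI) auto
    show "1 \<le> lux_norm \<Psi> (z n)"
    proof (rule lux_norm_geI[OF inz], rule ccontr)
      fix l :: real assume l: "0 < l" and le: "orlicz_mod \<Psi> (z n) l \<le> 1" and "\<not> 1 \<le> l"
      \<comment> \<open>For \<open>l < 1\<close> convexity gives
        \<open>\<Psi> (s / l) \<ge> \<Psi> s / l\<close>, so the modular is at least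
        \<open>1 / l > 1\<close>.\<close>
      have "ennreal (1 / l) = (\<Sum>k. ennreal (1 / l * (1/2)^(k + 1)))"
        using l by (intro geom[symmetric]) auto
      also have "\<dots> \<le> orlicz_mod \<Psi> (z n) l"
        unfolding mod[OF l]
      proof (intro suminf_le summableI ennreal_leI)
        fix k
        have "\<Psi> (l * (u n k / l)) \<le> l * \<Psi> (u n k / l)"
          using l u(1)[of n k] \<open>\<not> 1 \<le> l\<close> by (intro orlicz_function_scale[OF \<Psi>]) auto
        then have "1 / l \<le> \<Psi> (u n k / l) / \<Psi> (u n k)"
          using l \<Psi>pos[of n k] by (simp add: field_simps)
        then have "1 / l * (1/2)^(k + 1) \<le> \<Psi> (u n k / l) / \<Psi> (u n k) * (1/2)^(k + 1)"
          by (intro mult_right_mono) auto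
        then show "1 / l * (1/2)^(k + 1) \<le> (1/2)^(k + 1) * \<Psi> (u n k / l) / \<Psi> (u n k)"
          by (simp only: times_divide_eq_right times_divide_eq_left mult.commute)
      qed
      also note le
      finally show False using l \<open>\<not> 1 \<le> l\<close> by (simp add: field_simps)
    qed
  qed
  moreover have "pairwise_disjoint_seq z"
    unfolding pairwise_disjoint_seq_def
  proof (intro allI impI)
    fix n m :: nat assume "n \<noteq> m"
    then have "z n t = 0 \<or> z m t = 0" for t
      using z_out J_disj by (metis prod.inject)
    then have "{t \<in> {0..1}. z n t \<noteq> 0 \<and> z m t \<noteq> 0} = {}" by auto
    then show "emeasure lebesgue {t \<in> {0..1}. z n t \<noteq> 0 \<and> z m t \<noteq> 0} = 0" by (simp only: emeasure_empty)
  qed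
  ultimately have "normalized_disjoint \<Psi> z"
    using inz by (simp add: normalized_disjoint_def)
  then show ?thesis using mod that by blast
qed

text \<open>From \<open>fast\<close> comes \<open>x\<close>, whose modulars at scale 2 are so small
  that sums along any subsequence have norm at most 2. In \<open>slow\<close>,
  \<open>\<delta>\<close> depends on \<open>k\<close> alone, so at scale \<open>2 ^ k\<close> all
  members of \<open>y\<close> keep a common positive modular, and enough of them exceed 1.\<close>

lemma not_DH_criterion:
  assumes \<Psi>: "orlicz_function \<Psi>"
    and fast: "\<And>\<delta> N. 0 < \<delta> \<Longrightarrow> \<exists>u>0. N \<le> \<Psi> u \<and> \<Psi> (u / 2) \<le> \<delta> * \<Psi> u"
    and slow: "\<And>k::nat. \<exists>\<delta>>0. \<forall>N. \<exists>u>0. N \<le> \<Psi> u \<and> \<delta> * \<Psi> u \<le> \<Psi> (u / 2 ^ k)"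
  shows "\<not> DH \<Psi>"
proof
  assume DH: "DH \<Psi>"
  have "\<exists>u>0. 2 ^ (prod_encode (n, k) + 1) \<le> \<Psi> u \<and> \<Psi> (u / 2) \<le> (1/2)^(n + 1) * \<Psi> u" for n k :: nat
    by (rule fast) simp
  then obtain u where u: "\<And>n k. 0 < u n k" "\<And>n k. 2 ^ (prod_encode (n, k) + 1) \<le> \<Psi> (u n k)"
    "\<And>n k. \<Psi> (u n k / 2) \<le> (1/2)^(n + 1) * \<Psi> (u n k)"
    by metis
  obtain \<delta> where \<delta>: "\<And>k. 0 < \<delta> k" "\<And>k N. \<exists>u>0. N \<le> \<Psi> u \<and> \<delta> k * \<Psi> u \<le> \<Psi> (u / 2 ^ k)"
    using slow by metis
  have "\<exists>v>0. 2 ^ (prod_encode (n, k) + 1) \<le> \<Psi> v \<and> \<delta> k * \<Psi> v \<le> \<Psi> (v / 2 ^ k)" for n k :: nat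
    by (rule \<delta>(2))
  then obtain v where v: "\<And>n k. 0 < v n k" "\<And>n k. 2 ^ (prod_encode (n, k) + 1) \<le> \<Psi> (v n k)"
    "\<And>n k. \<delta> k * \<Psi> (v n k) \<le> \<Psi> (v n k / 2 ^ k)"
    by metis
  obtain x where x: "normalized_disjoint \<Psi> x" and
    xmod: "\<And>n l. 0 < l \<Longrightarrow> orlicz_mod \<Psi> (x n) l = (\<Sum>k. ennreal ((1/2)^(k + 1) * \<Psi> (u n k / l) / \<Psi> (u n k)))"
    using ex_normalized_disjoint_steps[where u=u, OF \<Psi> u(1,2)] by blast
  obtain y where y: "normalized_disjoint \<Psi> y" and
    ymod: "\<And>n l. 0 < l \<Longrightarrow> orlicz_mod \<Psi> (y n) l = (\<Sum>k. ennreal ((1/2)^(k + 1) * \<Psi> (v n k / l) / \<Psi> (v n k)))"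
    using ex_normalized_disjoint_steps[where u=v, OF \<Psi> v(1,2)] by blast
  have x2: "orlicz_mod \<Psi> (x n) 2 \<le> ennreal ((1/2)^(n + 1))" for n
  proof -
    have "orlicz_mod \<Psi> (x n) 2 \<le> (\<Sum>k. ennreal ((1/2)^(n + 1) * (1/2)^(k + 1)))"
      unfolding xmod[OF zero_less_numeral]
    proof (intro suminf_le summableI ennreal_leI)
      fix k
      have pos: "0 < \<Psi> (u n k)" by (rule less_le_trans[OF _ u(2)]) simp
      have "\<Psi> (u n k / 2) / \<Psi> (u n k) \<le> (1/2)^(n + 1)"
        using u(3)[of n k] pos by (simp only: pos_divide_le_eq)
      then have "(1/2)^(k + 1) * (\<Psi> (u n k / 2) / \<Psi> (u n k)) \<le> (1/2)^(k + 1) * (1/2)^(n + 1)"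
        by (intro mult_left_mono) auto
      then show "(1/2)^(k + 1) * \<Psi> (u n k / 2) / \<Psi> (u n k) \<le> (1/2)^(n + 1) * (1/2)^(k + 1)"
        by (simp only: times_divide_eq_right mult.commute)
    qed
    also have "\<dots> = ennreal ((1/2)^(n + 1))"
    proof (rule suminf_ennreal_eq)
      show "(\<lambda>k. (1/2)^(n + 1) * (1/2)^(k + 1)) sums ((1/2::real)^(n + 1))"
        using sums_mult[OF power_half_series, of "(1/2)^(n + 1)"] by simp
    qed auto
    finally show ?thesis .
  qed
  have y2: "ennreal ((1/2)^(k + 1) * \<delta> k) \<le> orlicz_mod \<Psi> (y n) (2 ^ k)" for n k
  proof -
    have pos: "0 < \<Psi> (v n k)" by (rule less_le_trans[OF _ v(2)]) simp
    have "\<delta> k \<le> \<Psi> (v n k / 2 ^ k) / \<Psi> (v n k)"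
      using v(3)[of k n] pos by (simp only: pos_le_divide_eq)
    then have "(1/2)^(k + 1) * \<delta> k \<le> (1/2)^(k + 1) * (\<Psi> (v n k / 2 ^ k) / \<Psi> (v n k))"
      by (intro mult_left_mono) auto
    then have "ennreal ((1/2)^(k + 1) * \<delta> k) \<le> ennreal ((1/2)^(k + 1) * \<Psi> (v n k / 2 ^ k) / \<Psi> (v n k))"
      by (intro ennreal_leI) (simp only: times_divide_eq_right)
    also have "\<dots> = (\<Sum>j\<in>{k}. ennreal ((1/2)^(j + 1) * \<Psi> (v n j / 2 ^ k) / \<Psi> (v n j)))" by simp
    also have "\<dots> \<le> orlicz_mod \<Psi> (y n) (2 ^ k)"
      by (subst ymod) (simp, intro sum_le_suminf summableI, auto)
    finally show ?thesis .
  qed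
  obtain \<sigma> where \<sigma>: "strict_mono \<sigma>" and "seq_equiv \<Psi> (x \<circ> \<sigma>) (y \<circ> \<sigma>)"
    using DH x y unfolding DH_def by blast
  then obtain C where C: "0 < C"
    "\<And>n a. lux_norm \<Psi> (lin_comb a (y \<circ> \<sigma>) n) \<le> C * lux_norm \<Psi> (lin_comb a (x \<circ> \<sigma>) n)"
    unfolding seq_equiv_def by blast
  have mod_sum: "orlicz_mod \<Psi> (lin_comb (\<lambda>_. 1) (z \<circ> \<sigma>) n) l = (\<Sum>i<n. orlicz_mod \<Psi> (z (\<sigma> i)) l)"
    if z: "normalized_disjoint \<Psi> z" and "0 < l" for z n l
  proof -
    note z' = normalized_disjoint_compose[OF z \<sigma>]
    have "(z \<circ> \<sigma>) i \<in> borel_measurable lebesgue" for i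
      using z' by (auto simp: normalized_disjoint_def in_orlicz_def)
    then show ?thesis
      using z' \<open>0 < l\<close> unfolding normalized_disjoint_def
      by (subst orlicz_mod_lin_comb[OF \<Psi>]) (auto simp: orlicz_mod_def)
  qed
  have xnorm: "lux_norm \<Psi> (lin_comb (\<lambda>_. 1) (x \<circ> \<sigma>) n) \<le> 2" for n
  proof (rule lux_norm_leI)
    have "orlicz_mod \<Psi> (lin_comb (\<lambda>_. 1) (x \<circ> \<sigma>) n) 2 \<le> (\<Sum>i<n. ennreal ((1/2)^(i + 1)))"
      unfolding mod_sum[OF x zero_less_numeral]
    proof (rule sum_mono)
      fix i
      have "orlicz_mod \<Psi> (x (\<sigma> i)) 2 \<le> ennreal ((1/2)^(\<sigma> i + 1))" by (rule x2)
      \<comment> \<open>Since \<open>\<sigma> i \<ge> i\<close>, the decay survives the passage to a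
        subsequence.\<close>
      also have "\<dots> \<le> ennreal ((1/2)^(i + 1))"
        using strict_mono_imp_increasing[OF \<sigma>, of i] by (intro ennreal_leI power_decreasing) auto
      finally show "orlicz_mod \<Psi> (x (\<sigma> i)) 2 \<le> ennreal ((1/2)^(i + 1))" .
    qed
    also have "\<dots> = ennreal (\<Sum>i<n. (1/2)^(i + 1))"
      by (rule sum_ennreal) simp
    also have "\<dots> \<le> 1"
      unfolding ennreal_le_1 power_add sum_distrib_right[symmetric]
      by (subst geometric_sum) (simp_all add: field_simps)
    finally show "orlicz_mod \<Psi> (lin_comb (\<lambda>_. 1) (x \<circ> \<sigma>) n) 2 \<le> 1" .
  qed simp
  \<comment> \<open>Equivalence with constant \<open>C\<close> bounds the norms of the sums of
    \<open>y\<close> by \<open>2 * C\<close>. At the larger scale \<open>2 ^ k\<close> their modular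
    is then at most 1 for every \<open>n\<close>, against \<open>n * d > 1\<close> below.\<close>
  obtain k :: nat where k: "2 * C < 2 ^ k" using real_arch_pow[of 2 "2 * C"] by auto
  define d where "d = (1/2)^(k + 1) * \<delta> k"
  have "0 < d" using \<delta>(1) by (simp add: d_def)
  then obtain n :: nat where n: "1 < real n * d" using reals_Archimedean3 by blast
  have "lux_norm \<Psi> (lin_comb (\<lambda>_. 1) (y \<circ> \<sigma>) n) \<le> C * 2"
    using C(2)[of "\<lambda>_. 1" n] mult_left_mono[OF xnorm[of n], of C] C(1) by linarith
  then have "orlicz_mod \<Psi> (lin_comb (\<lambda>_. 1) (y \<circ> \<sigma>) n) (2 ^ k) \<le> 1"
    using k by (intro orlicz_mod_le_oneI[OF \<Psi> in_orlicz_lin_comb[OF \<Psi> normalized_disjoint_compose[OF y \<sigma>]]]) linarith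
  moreover have "ennreal (real n * d) \<le> orlicz_mod \<Psi> (lin_comb (\<lambda>_. 1) (y \<circ> \<sigma>) n) (2 ^ k)"
  proof -
    have "ennreal (real n * d) = (\<Sum>i<n. ennreal d)"
      using \<open>0 < d\<close> by (subst sum_ennreal) auto
    also have "\<dots> \<le> (\<Sum>i<n. orlicz_mod \<Psi> (y (\<sigma> i)) (2 ^ k))"
      unfolding d_def by (intro sum_mono y2)
    finally show ?thesis by (subst mod_sum[OF y]) auto
  qed
  ultimately have "ennreal (real n * d) \<le> 1" by (rule order_trans[rotated])
  then show False using n by simp
qed

section \<open>Young conjugates\<close>

lemma young_conj_ge:
  assumes "bdd_above ((\<lambda>t. u * t - \<Phi> t) ` {0<..})" "0 < t"
  shows "u * t - \<Phi> t \<le> young_conj \<Phi> u"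
  unfolding young_conj_def using assms by (intro cSUP_upper) auto

lemma young_conj_le:
  assumes "\<And>t. 0 < t \<Longrightarrow> u * t - \<Phi> t \<le> b"
  shows "young_conj \<Phi> u \<le> b"
  unfolding young_conj_def using assms by (intro cSUP_least) (auto intro: gt_ex)

text \<open>A supremum of affine functions of \<open>u\<close> with slopes \<open>t > 0\<close> is
  monotone and convex. The zero at \<open>a > 0\<close> gives the lower bound \<open>a * u\<close>,
  hence nonnegativity at 0 and growth to infinity.\<close>

lemma orlicz_function_young_conj:
  assumes \<Phi>: "orlicz_function \<Phi>" and a: "0 < a" "\<Phi> a = 0"
    and bdd: "\<And>u. 0 \<le> u \<Longrightarrow> bdd_above ((\<lambda>t. u * t - \<Phi> t) ` {0<..})"
  shows "orlicz_function (young_conj \<Phi>)"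
  unfolding orlicz_function_def
proof (intro conjI)
  note ge = young_conj_ge[OF bdd]
  show "young_conj \<Phi> 0 = 0"
  proof (rule antisym)
    show "young_conj \<Phi> 0 \<le> 0"
      using orlicz_function_nonneg[OF \<Phi>] by (intro young_conj_le) simp
    show "0 \<le> young_conj \<Phi> 0" using ge[of 0 a] a by simp
  qed
  show "mono_on {0..} (young_conj \<Phi>)"
  proof (rule mono_onI)
    fix u v :: real assume uv: "u \<in> {0..}" "v \<in> {0..}" "u \<le> v"
    have gev: "v * t - \<Phi> t \<le> young_conj \<Phi> v" if "0 < t" for t
      using uv that by (intro ge) auto
    show "young_conj \<Phi> u \<le> young_conj \<Phi> v"
    proof (rule young_conj_le)
      fix t :: real assume t: "0 < t"
      then have "u * t \<le> v * t" using uv by (intro mult_right_mono) auto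
      then show "u * t - \<Phi> t \<le> young_conj \<Phi> v" using gev[OF t] by linarith
    qed
  qed
  show "convex_on {0..} (young_conj \<Phi>)"
  proof (rule convex_onI)
    fix \<theta> u v :: real assume h: "0 < \<theta>" "\<theta> < 1" "u \<in> {0..}" "v \<in> {0..}"
    show "young_conj \<Phi> ((1 - \<theta>) *\<^sub>R u + \<theta> *\<^sub>R v) \<le> (1 - \<theta>) * young_conj \<Phi> u + \<theta> * young_conj \<Phi> v"
    proof (rule young_conj_le)
      fix t :: real assume t: "0 < t"
      have "((1 - \<theta>) *\<^sub>R u + \<theta> *\<^sub>R v) * t - \<Phi> t = (1 - \<theta>) * (u * t - \<Phi> t) + \<theta> * (v * t - \<Phi> t)"
        by (simp add: algebra_simps)
      also have "\<dots> \<le> (1 - \<theta>) * young_conj \<Phi> u + \<theta> * young_conj \<Phi> v"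
        using h t by (intro add_mono mult_left_mono ge) auto
      finally show "((1 - \<theta>) *\<^sub>R u + \<theta> *\<^sub>R v) * t - \<Phi> t \<le> (1 - \<theta>) * young_conj \<Phi> u + \<theta> * young_conj \<Phi> v" .
    qed
  qed simp
  have "filterlim (\<lambda>u. a * u) at_top at_top"
    by (rule filterlim_tendsto_pos_mult_at_top[OF tendsto_const a(1) filterlim_ident])
  then show "filterlim (young_conj \<Phi>) at_top at_top"
  proof (rule filterlim_at_top_mono)
    show "\<forall>\<^sub>F u in at_top. a * u \<le> young_conj \<Phi> u"
      using eventually_ge_at_top[of 0]
    proof eventually_elim
      case (elim u)
      then show ?case using ge[of u a] a by (simp add: mult.commute)
    qed
  qed
qed

section \<open>The Orlicz function\<close>

text \<open>Along the diagonal \<open>d + n = b\<close> of the pairing function consecutive indices have consecutive \<open>d\<close>.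
  So diagonal \<open>b\<close> starts with a huge gap at \<open>d = 0\<close>, continues with a block of \<open>k\<close> gaps of size \<open>2\<^sup>k\<close>,
  and is filled up with huge gaps; every \<open>k\<close> occurs for infinitely many \<open>b\<close>.\<close>

definition gap_exponent :: "nat \<Rightarrow> nat" where
  "gap_exponent j = (let (d, n) = prod_decode j; k = fst (prod_decode (d + n))
     in if 1 \<le> d \<and> d \<le> k then k else j + 1)"

definition breakpoint :: "nat \<Rightarrow> real" where
  "breakpoint j = 2 ^ (\<Sum>i<j. gap_exponent i)"

text \<open>This is the Phi of the overview, with s_j = \<open>breakpoint j\<close>, written as the
  upper envelope of ramps: convexity passes to the supremum, and every single ramp is a lower
  bound.\<close>

definition sparse_orlicz :: "real \<Rightarrow> real" where
  "sparse_orlicz t = (SUP j. max 0 (2 ^ j * (t - breakpoint j)))"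

section \<open>Positions of the blocks and of the huge gaps\<close>

lemma prod_encode_diagonal: "d \<le> n \<Longrightarrow> prod_encode (d, n - d) = prod_encode (0, n) + d"
  by (simp add: prod_encode_def)

lemma gap_exponent_pos: "1 \<le> gap_exponent j"
  by (auto simp: gap_exponent_def Let_def split: prod.split)

lemma gap_exponent_diagonal_start: "gap_exponent (prod_encode (0, n)) = prod_encode (0, n) + 1"
  by (simp add: gap_exponent_def)

text \<open>The block fits into the diagonal \<open>prod_encode (k, q)\<close> because this number
  is at least \<open>k\<close>. The free \<open>q\<close> provides infinitely many copies of each
  type.\<close>

lemma gap_exponent_block:
  assumes "1 \<le> d" "d \<le> k"
  shows "gap_exponent (prod_encode (0, prod_encode (k, q)) + d) = k"
proof -
  have "d \<le> prod_encode (k, q)" using assms le_prod_encode_1[of k q] by simp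
  then show ?thesis
    using assms by (simp add: gap_exponent_def flip: prod_encode_diagonal)
qed

text \<open>A huge gap at \<open>j\<close> would have exponent \<open>j + 1 > B\<close>, so
  \<open>j\<close> lies in a block, at an offset \<open>d\<close> bounded by the type and hence by
  \<open>B\<close>. Going back \<open>d\<close> steps reaches the start of the diagonal, where the
  gap is huge.\<close>

lemma gap_exponent_le_imp_large_gap:
  assumes "gap_exponent j \<le> B" "B \<le> j"
  obtains l where "l \<le> B" "l \<le> j" "gap_exponent (j - l) = j - l + 1"
proof -
  obtain d n where dn: "prod_decode j = (d, n)" by force
  have d: "1 \<le> d" "d \<le> B"
    using assms by (auto simp: gap_exponent_def dn Let_def split: if_splits)
  have "j = prod_encode (d, n)" using dn by (metis prod_decode_inverse)
  then have "j - d = prod_encode (0, d + n)" "d \<le> j"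
    using prod_encode_diagonal[of d "d + n"] by auto
  then show ?thesis
    using that[of d] d gap_exponent_diagonal_start[of "d + n"] by simp
qed

section \<open>Growth of the breakpoints\<close>

lemma breakpoint_0: "breakpoint 0 = 1"
  by (simp add: breakpoint_def)

lemma breakpoint_Suc: "breakpoint (Suc j) = 2 ^ gap_exponent j * breakpoint j"
  by (simp add: breakpoint_def power_add mult.commute)

lemma breakpoint_pos: "0 < breakpoint j"
  by (simp add: breakpoint_def)

lemma two_breakpoint_le: "2 * breakpoint j \<le> breakpoint (Suc j)"
proof -
  have "(2::real) ^ 1 \<le> 2 ^ gap_exponent j"
    using gap_exponent_pos by (intro power_increasing) auto
  then show ?thesis
    unfolding breakpoint_Suc using breakpoint_pos[of j] by (intro mult_right_mono) auto
qed

lemma breakpoint_mono: "i \<le> j \<Longrightarrow> breakpoint i \<le> breakpoint j"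
proof (rule lift_Suc_mono_le)
  show "breakpoint n \<le> breakpoint (Suc n)" for n
    using two_breakpoint_le[of n] breakpoint_pos[of n] by simp
qed

lemma power_le_breakpoint: "2 ^ j \<le> breakpoint j"
proof (induction j)
  case (Suc j)
  then show ?case using two_breakpoint_le[of j] by simp
qed (simp add: breakpoint_0)

lemma ex_breakpoint_bracket:
  assumes "breakpoint m \<le> s"
  obtains j where "m \<le> j" "breakpoint j \<le> s" "s < breakpoint (Suc j)"
proof -
  obtain n where "s < 2 ^ n" using real_arch_pow[of 2 s] by auto
  then have n: "s < breakpoint n" using power_le_breakpoint[of n] by linarith
  define i where "i = (LEAST i. s < breakpoint i)"
  have i: "s < breakpoint i" unfolding i_def using n by (rule LeastI)
  then have "m < i" using assms breakpoint_mono[of i m] by (meson leD leI order_trans)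
  then obtain j where j: "i = Suc j" by (cases i) auto
  then have "\<not> s < breakpoint j" using not_less_Least[of j "\<lambda>i. s < breakpoint i"] by (simp add: i_def)
  then show ?thesis using that[of j] i j \<open>m < i\<close> by simp
qed

section \<open>Finiteness, size and convexity of \<open>sparse_orlicz\<close>\<close>

lemma sparse_orlicz_bdd: "bdd_above (range (\<lambda>j. max 0 (2 ^ j * (t - breakpoint j))))"
proof (rule bdd_aboveI2)
  fix j :: nat
  show "max 0 (2 ^ j * (t - breakpoint j)) \<le> t * t"
  \<comment> \<open>A positive ramp needs s_j below \<open>t\<close>, and its slope
    \<open>2 ^ j\<close> is at most s_j.\<close>
  proof (cases "breakpoint j \<le> t")
    case True
    then have "2 ^ j * (t - breakpoint j) \<le> t * t"
      using power_le_breakpoint[of j] breakpoint_pos[of j] by (intro mult_mono) auto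
    then show ?thesis by simp
  next
    case False
    then have "2 ^ j * (t - breakpoint j) \<le> 0" by (simp add: mult_le_0_iff)
    then show ?thesis by simp
  qed
qed

lemma sparse_orlicz_ge: "2 ^ j * (t - breakpoint j) \<le> sparse_orlicz t"
proof -
  have "max 0 (2 ^ j * (t - breakpoint j)) \<le> sparse_orlicz t"
    unfolding sparse_orlicz_def by (rule cSUP_upper[OF UNIV_I sparse_orlicz_bdd])
  then show ?thesis by simp
qed

lemma sparse_orlicz_nonneg: "0 \<le> sparse_orlicz t"
proof -
  have "max 0 (2 ^ 0 * (t - breakpoint 0)) \<le> sparse_orlicz t"
    unfolding sparse_orlicz_def by (rule cSUP_upper[OF UNIV_I sparse_orlicz_bdd])
  then show ?thesis by simp
qed

lemma sparse_orlicz_leI: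
  assumes "0 \<le> b" "\<And>j. 2 ^ j * (t - breakpoint j) \<le> b"
  shows "sparse_orlicz t \<le> b"
  unfolding sparse_orlicz_def using assms by (intro cSUP_least) auto

lemma sparse_orlicz_eq_0:
  assumes "t \<le> 1"
  shows "sparse_orlicz t = 0"
proof (rule antisym[OF sparse_orlicz_leI sparse_orlicz_nonneg])
  fix j
  have "t \<le> breakpoint j" using assms breakpoint_mono[of 0 j] by (simp add: breakpoint_0)
  then show "2 ^ j * (t - breakpoint j) \<le> 0" by (simp add: mult_le_0_iff)
qed simp

text \<open>Up to s_(j+1) only the ramps 0 to \<open>j\<close> can be positive, and their slopes are
  at most \<open>2 ^ j\<close>.\<close>

lemma sparse_orlicz_le:
  assumes "0 \<le> t" "t \<le> breakpoint (Suc j)"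
  shows "sparse_orlicz t \<le> 2 ^ j * t"
proof (rule sparse_orlicz_leI)
  fix i
  show "2 ^ i * (t - breakpoint i) \<le> 2 ^ j * t"
  proof (cases "i \<le> j")
    case True
    then have "(2::real) ^ i \<le> 2 ^ j" by (intro power_increasing) auto
    moreover have "2 ^ i * (t - breakpoint i) \<le> 2 ^ i * t"
      using breakpoint_pos[of i] by (intro mult_left_mono) auto
    ultimately show ?thesis using assms mult_right_mono[of "2 ^ i" "2 ^ j" t] by linarith
  next
    case False
    then have "t \<le> breakpoint i" using assms breakpoint_mono[of "Suc j" i] by simp
    then have "2 ^ i * (t - breakpoint i) \<le> 0" by (simp add: mult_le_0_iff)
    also have "\<dots> \<le> 2 ^ j * t" using assms by simp
    finally show ?thesis .
  qed
qed (use assms in simp)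

text \<open>Successive ratios are at least 2, so from s_(j+1) on the offset s_j costs ramp
  \<open>j\<close> at most half of \<open>2 ^ j * t\<close>. With \<open>sparse_orlicz_le\<close>
  this determines the function on [s_(j+1), s_(j+2)] up to a factor 4.\<close>

lemma sparse_orlicz_ge_half:
  assumes "breakpoint (Suc j) \<le> t"
  shows "2 ^ j * t / 2 \<le> sparse_orlicz t"
proof -
  have "2 ^ j * (t / 2) \<le> 2 ^ j * (t - breakpoint j)"
    using assms two_breakpoint_le[of j] by (intro mult_left_mono) auto
  also have "\<dots> \<le> sparse_orlicz t" by (rule sparse_orlicz_ge)
  finally show ?thesis by simp
qed

lemma orlicz_function_sparse_orlicz: "orlicz_function sparse_orlicz"
  unfolding orlicz_function_def
proof (intro conjI)
  show "sparse_orlicz 0 = 0" by (rule sparse_orlicz_eq_0) simp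
  show "mono_on {0..} sparse_orlicz"
  proof (rule mono_onI)
    fix s t :: real assume "s \<le> t"
    show "sparse_orlicz s \<le> sparse_orlicz t"
    proof (rule sparse_orlicz_leI[OF sparse_orlicz_nonneg])
      fix j
      have "2 ^ j * (s - breakpoint j) \<le> 2 ^ j * (t - breakpoint j)"
        using \<open>s \<le> t\<close> by (intro mult_left_mono) auto
      then show "2 ^ j * (s - breakpoint j) \<le> sparse_orlicz t"
        using sparse_orlicz_ge[of j t] by linarith
    qed
  qed
  show "convex_on {0..} sparse_orlicz"
  proof (rule convex_onI)
    fix \<theta> s t :: real assume h: "0 < \<theta>" "\<theta> < 1"
    show "sparse_orlicz ((1 - \<theta>) *\<^sub>R s + \<theta> *\<^sub>R t) \<le> (1 - \<theta>) * sparse_orlicz s + \<theta> * sparse_orlicz t"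
    proof (rule sparse_orlicz_leI)
      show "0 \<le> (1 - \<theta>) * sparse_orlicz s + \<theta> * sparse_orlicz t"
        using h by (intro add_nonneg_nonneg mult_nonneg_nonneg sparse_orlicz_nonneg) auto
      fix j
      have "2 ^ j * ((1 - \<theta>) *\<^sub>R s + \<theta> *\<^sub>R t - breakpoint j)
          = (1 - \<theta>) * (2 ^ j * (s - breakpoint j)) + \<theta> * (2 ^ j * (t - breakpoint j))"
        by (simp add: algebra_simps)
      also have "\<dots> \<le> (1 - \<theta>) * sparse_orlicz s + \<theta> * sparse_orlicz t"
        using h by (intro add_mono mult_left_mono sparse_orlicz_ge) auto
      finally show "2 ^ j * ((1 - \<theta>) *\<^sub>R s + \<theta> *\<^sub>R t - breakpoint j)
          \<le> (1 - \<theta>) * sparse_orlicz s + \<theta> * sparse_orlicz t" .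
    qed
  qed simp
  have "filterlim (\<lambda>t::real. - 1 + t) at_top at_top"
    by (rule filterlim_tendsto_add_at_top[OF tendsto_const filterlim_ident])
  then show "filterlim sparse_orlicz at_top at_top"
    by (rule filterlim_at_top_mono)
      (use sparse_orlicz_ge[of 0] in \<open>auto simp: breakpoint_0\<close>)
qed

text \<open>Let \<open>s\<close> lie in [s_i, s_(i+1)). Either \<open>\<epsilon>0 * s\<close> is
  still at least s_(i-1), which costs only a fixed factor, or the ratio s_i / s_(i-1) is below
  \<open>1 / \<epsilon>0\<close>. Then a huge gap lies at most \<open>B\<close> steps further down,
  and \<open>\<epsilon> * s\<close> does not fall below its left end.\<close>

lemma one_DH_sparse_orlicz: "one_DH sparse_orlicz"
proof (rule one_DH_criterion[OF orlicz_function_sparse_orlicz, of "1/8"])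
  fix \<epsilon>0 :: real assume \<epsilon>0: "0 < \<epsilon>0"
  obtain B where B: "1 / \<epsilon>0 < 2 ^ B" using real_arch_pow[of 2 "1 / \<epsilon>0"] by auto
  show "\<exists>c>0. \<forall>\<epsilon>>0. \<exists>S. \<forall>s\<ge>S. 1/8 * \<epsilon>0 * sparse_orlicz s \<le> sparse_orlicz (\<epsilon>0 * s)
      \<or> c * \<epsilon> * sparse_orlicz s \<le> sparse_orlicz (\<epsilon> * s)"
  \<comment> \<open>The index \<open>i\<close> exceeds the ramp index \<open>q\<close> found below
    by at most \<open>B + 2\<close>; one more factor 2 comes from
    \<open>sparse_orlicz_ge_half\<close>.\<close>
  proof (rule exI[of _ "1 / 2 ^ (B + 3)"], intro conjI allI impI)
    fix \<epsilon> :: real assume \<epsilon>: "0 < \<epsilon>"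
    obtain M where M: "1 / \<epsilon> < 2 ^ M" using real_arch_pow[of 2 "1 / \<epsilon>"] by auto
    show "\<exists>S. \<forall>s\<ge>S. 1/8 * \<epsilon>0 * sparse_orlicz s \<le> sparse_orlicz (\<epsilon>0 * s)
      \<or> 1 / 2 ^ (B + 3) * \<epsilon> * sparse_orlicz s \<le> sparse_orlicz (\<epsilon> * s)"
    \<comment> \<open>The threshold makes \<open>i - 1\<close> at least \<open>B\<close>, as
      \<open>gap_exponent_le_imp_large_gap\<close> requires, and keeps the gap found within
      \<open>B\<close> steps at least \<open>2 ^ M\<close>, above
      \<open>1 / \<epsilon>\<close>.\<close>
    proof (intro exI[of _ "breakpoint (M + B + 3)"] allI impI)
      fix s assume s: "breakpoint (M + B + 3) \<le> s"
      have "0 < s" using s breakpoint_pos[of "M + B + 3"] by linarith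
      obtain i where i: "M + B + 3 \<le> i" "breakpoint i \<le> s" "s < breakpoint (Suc i)"
        using ex_breakpoint_bracket[OF s] by blast
      obtain j where ij: "i = Suc (Suc j)" using i(1) by (metis add_leE numeral_3_eq_3 Suc_le_D Suc_le_mono)
      have up: "sparse_orlicz s \<le> 2 ^ i * s"
        using i \<open>0 < s\<close> by (intro sparse_orlicz_le) auto
      show "1/8 * \<epsilon>0 * sparse_orlicz s \<le> sparse_orlicz (\<epsilon>0 * s)
        \<or> 1 / 2 ^ (B + 3) * \<epsilon> * sparse_orlicz s \<le> sparse_orlicz (\<epsilon> * s)"
      proof (cases "breakpoint (Suc j) \<le> \<epsilon>0 * s")
        case True
        have "1/8 * \<epsilon>0 * sparse_orlicz s \<le> 1/8 * \<epsilon>0 * (2 ^ i * s)"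
          using up \<epsilon>0 by (intro mult_left_mono) auto
        \<comment> \<open>The 1/8 consists of 1/4 for the two indices between \<open>j\<close> and
          \<open>i\<close> and 1/2 from \<open>sparse_orlicz_ge_half\<close>.\<close>
        also have "\<dots> = 2 ^ j * (\<epsilon>0 * s) / 2" by (simp add: ij)
        also have "\<dots> \<le> sparse_orlicz (\<epsilon>0 * s)" by (rule sparse_orlicz_ge_half[OF True])
        finally show ?thesis ..
      next
        case False
        have "\<epsilon>0 * (2 ^ gap_exponent (Suc j) * breakpoint (Suc j)) \<le> \<epsilon>0 * s"
          using i(2) \<epsilon>0 unfolding ij breakpoint_Suc[of "Suc j"] by (intro mult_left_mono) auto
        also have "\<dots> < breakpoint (Suc j)" using False by simp
        finally have "\<epsilon>0 * 2 ^ gap_exponent (Suc j) < 1"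
          using breakpoint_pos[of "Suc j"] by (simp add: mult.assoc[symmetric])
        then have "2 ^ gap_exponent (Suc j) < 1 / \<epsilon>0" using \<epsilon>0 by (simp add: field_simps)
        then have "(2::real) ^ gap_exponent (Suc j) < 2 ^ B" using B by linarith
        then have "gap_exponent (Suc j) \<le> B" by simp
        then obtain l where l: "l \<le> B" "gap_exponent (Suc j - l) = Suc j - l + 1"
          using gap_exponent_le_imp_large_gap[of "Suc j" B] i(1) ij by auto
        obtain q where q: "Suc j - l = Suc q" using l i(1) ij by (cases "Suc j - l") auto
        have "2 ^ (q + 2) * breakpoint (Suc q) = breakpoint (Suc (Suc q))"
          using l(2) unfolding q breakpoint_Suc[of "Suc q"] by simp
        also have "\<dots> \<le> breakpoint i" using q ij by (intro breakpoint_mono) simp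
        also have "\<dots> \<le> s" by (rule i(2))
        finally have bq: "2 ^ (q + 2) * breakpoint (Suc q) \<le> s" .
        have "(2::real) ^ M \<le> 2 ^ (q + 2)"
          using q l i(1) ij by (intro power_increasing) auto
        then have "1 / \<epsilon> \<le> 2 ^ (q + 2)" using M by linarith
        then have "1 / \<epsilon> * breakpoint (Suc q) \<le> 2 ^ (q + 2) * breakpoint (Suc q)"
          using breakpoint_pos[of "Suc q"] by (intro mult_right_mono) auto
        then have "1 / \<epsilon> * breakpoint (Suc q) \<le> s" using bq by linarith
        then have le: "breakpoint (Suc q) \<le> \<epsilon> * s" using \<epsilon> by (simp add: field_simps)
        have "(2::real) ^ i \<le> 2 ^ (B + 2 + q)"
          using q l ij by (intro power_increasing) auto
        then have "2 ^ i * s \<le> 2 ^ (B + 2 + q) * s"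
          using \<open>0 < s\<close> by (intro mult_right_mono) auto
        then have "1 / 2 ^ (B + 3) * \<epsilon> * sparse_orlicz s \<le> 1 / 2 ^ (B + 3) * \<epsilon> * (2 ^ (B + 2 + q) * s)"
          using up \<epsilon> by (intro mult_left_mono) auto
        also have "\<dots> = 2 ^ q * (\<epsilon> * s) / 2" by (simp add: power_add)
        also have "\<dots> \<le> sparse_orlicz (\<epsilon> * s)" by (rule sparse_orlicz_ge_half[OF le])
        finally show ?thesis ..
      qed
    qed
  qed simp
qed simp

section \<open>The conjugate along powers of two\<close>

lemma sparse_orlicz_conj_term_le:
  assumes "u \<le> 2 ^ j" "0 < t"
  shows "u * t - sparse_orlicz t \<le> 2 ^ j * breakpoint j"
proof -
  \<comment> \<open>Subtracting ramp \<open>j\<close> alone from \<open>2 ^ j * t\<close> leaves the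
    constant on the right.\<close>
  have "u * t \<le> 2 ^ j * t" using assms by (intro mult_right_mono) auto
  then show ?thesis using sparse_orlicz_ge[of j t] by (simp add: algebra_simps)
qed

lemma sparse_orlicz_conj_bdd: "bdd_above ((\<lambda>t. u * t - sparse_orlicz t) ` {0<..})"
proof -
  obtain j where "u < 2 ^ j" using real_arch_pow[of 2 u] by auto
  then show ?thesis
    by (intro bdd_aboveI2[where M="2 ^ j * breakpoint j"] sparse_orlicz_conj_term_le) auto
qed

lemma orlicz_function_young_conj_sparse_orlicz: "orlicz_function (young_conj sparse_orlicz)"
  by (rule orlicz_function_young_conj[OF orlicz_function_sparse_orlicz _ sparse_orlicz_eq_0[of 1]
        sparse_orlicz_conj_bdd]) simp_all

lemma young_conj_sparse_orlicz_le: "young_conj sparse_orlicz (2 ^ j) \<le> 2 ^ j * breakpoint j"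
  by (intro young_conj_le sparse_orlicz_conj_term_le) auto

text \<open>The supremum is tested at \<open>breakpoint (Suc j)\<close>, where
  \<open>sparse_orlicz\<close> takes away at most half of the linear term. With the upper bound this
  fixes the conjugate at powers of two up to a factor 2.\<close>

lemma young_conj_sparse_orlicz_ge:
  "2 ^ j * breakpoint (Suc j) \<le> young_conj sparse_orlicz (2 ^ Suc j)"
proof -
  have "sparse_orlicz (breakpoint (Suc j)) \<le> 2 ^ j * breakpoint (Suc j)"
    using breakpoint_pos[of "Suc j"] by (intro sparse_orlicz_le) auto
  moreover have "2 ^ Suc j * breakpoint (Suc j) - sparse_orlicz (breakpoint (Suc j))
      \<le> young_conj sparse_orlicz (2 ^ Suc j)"
    by (intro young_conj_ge sparse_orlicz_conj_bdd breakpoint_pos)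
  ultimately show ?thesis by simp
qed

lemma young_conj_sparse_orlicz_ge_power: "2 ^ j \<le> young_conj sparse_orlicz (2 ^ Suc j)"
proof -
  have "2 ^ j * 1 \<le> 2 ^ j * breakpoint (Suc j)"
    using breakpoint_mono[of 0 "Suc j"] by (intro mult_left_mono) (auto simp: breakpoint_0)
  also have "\<dots> \<le> young_conj sparse_orlicz (2 ^ Suc j)"
    by (rule young_conj_sparse_orlicz_ge)
  finally show ?thesis by simp
qed

text \<open>At the start \<open>j\<close> of a diagonal s_(j+1) = 2^(j+1) s_j, so halving
  \<open>u = 2 ^ Suc j\<close> divides the conjugate by at least 2^(j+1).\<close>

lemma young_conj_sparse_orlicz_fast:
  assumes "0 < \<delta>"
  shows "\<exists>u>0. N \<le> young_conj sparse_orlicz u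
    \<and> young_conj sparse_orlicz (u / 2) \<le> \<delta> * young_conj sparse_orlicz u"
proof -
  obtain b where b: "max N (1 / \<delta>) < 2 ^ b" using real_arch_pow[of 2 "max N (1 / \<delta>)"] by auto
  define j where "j = prod_encode (0, b)"
  have "b \<le> j" unfolding j_def by (rule le_prod_encode_2)
  then have "(2::real) ^ b \<le> 2 ^ j" by (intro power_increasing) auto
  with b have N: "N \<le> 2 ^ j" and "1 / \<delta> \<le> 2 ^ j"
    unfolding max_less_iff_conj by linarith+
  then have \<delta>: "1 \<le> \<delta> * 2 ^ Suc j" using assms by (simp add: field_simps)
  have "young_conj sparse_orlicz (2 ^ j) \<le> 1 * (2 ^ j * breakpoint j)"
    using young_conj_sparse_orlicz_le by simp
  also have "\<dots> \<le> (\<delta> * 2 ^ Suc j) * (2 ^ j * breakpoint j)"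
    using \<delta> breakpoint_pos[of j] by (intro mult_right_mono) auto
  also have "\<dots> = \<delta> * (2 ^ j * breakpoint (Suc j))"
    unfolding breakpoint_Suc j_def gap_exponent_diagonal_start by simp
  also have "\<dots> \<le> \<delta> * young_conj sparse_orlicz (2 ^ Suc j)"
    using assms by (intro mult_left_mono young_conj_sparse_orlicz_ge) auto
  finally show ?thesis
    using N young_conj_sparse_orlicz_ge_power[of j] by (intro exI[of _ "2 ^ Suc j"]) auto
qed

text \<open>In a block of type \<open>Suc k\<close> the breakpoints grow by exactly
  \<open>2 ^ (k * Suc k)\<close> over \<open>k\<close> steps, wherever the block lies, so one
  \<open>\<delta>\<close> serves arbitrarily large \<open>u\<close>.\<close>

lemma young_conj_sparse_orlicz_slow:
  "\<exists>\<delta>>0. \<forall>N. \<exists>u>0. N \<le> young_conj sparse_orlicz u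
    \<and> \<delta> * young_conj sparse_orlicz u \<le> young_conj sparse_orlicz (u / 2 ^ k)"
\<comment> \<open>In the exponent \<open>k * Suc k\<close> comes from the breakpoints,
  \<open>k\<close> from the ratio of the arguments and 1 from the factor between the two bounds on
  the conjugate.\<close>
proof (rule exI[of _ "1 / 2 ^ (1 + k + k * Suc k)"], intro conjI allI)
  fix N :: real
  obtain q where q: "N < real q" using reals_Archimedean2 by blast
  \<comment> \<open>\<open>T\<close> starts the diagonal holding copy \<open>q\<close> of the block;
    \<open>q \<le> T\<close> pushes the conjugate above \<open>N\<close>.\<close>
  define T where "T = prod_encode (0, prod_encode (Suc k, q))"
  have "q \<le> T" unfolding T_def by (meson le_prod_encode_2 order_trans)
  also have "T < 2 ^ T" by (rule less_exp)
  finally have "real q < 2 ^ T" by (metis of_nat_less_iff of_nat_numeral of_nat_power)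
  have "breakpoint (Suc T + i) = 2 ^ (i * Suc k) * breakpoint (Suc T)" if "i \<le> k" for i
    using that
  proof (induction i)
    case (Suc i)
    have "gap_exponent (Suc T + i) = Suc k"
      using gap_exponent_block[of "Suc i" "Suc k" q] Suc.prems by (simp add: T_def)
    then have "breakpoint (Suc T + Suc i) = 2 ^ Suc k * breakpoint (Suc T + i)"
      using breakpoint_Suc[of "Suc T + i"] by simp
    then show ?case using Suc by (simp add: power_add)
  qed simp
  then have bp: "breakpoint (Suc T + k) = 2 ^ (k * Suc k) * breakpoint (Suc T)" by simp
  have "1 / 2 ^ (1 + k + k * Suc k) * young_conj sparse_orlicz (2 ^ (Suc T + k))
      \<le> 1 / 2 ^ (1 + k + k * Suc k) * (2 ^ (Suc T + k) * breakpoint (Suc T + k))"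
    by (intro mult_left_mono young_conj_sparse_orlicz_le) simp
  also have "\<dots> = 2 ^ T * breakpoint (Suc T)"
    unfolding bp by (simp add: power_add)
  also have "\<dots> \<le> young_conj sparse_orlicz (2 ^ Suc T)" by (rule young_conj_sparse_orlicz_ge)
  also have "(2::real) ^ Suc T = 2 ^ (Suc T + k) / 2 ^ k" by (simp add: power_add)
  finally have "1 / 2 ^ (1 + k + k * Suc k) * young_conj sparse_orlicz (2 ^ (Suc T + k))
      \<le> young_conj sparse_orlicz (2 ^ (Suc T + k) / 2 ^ k)" .
  moreover have "N \<le> young_conj sparse_orlicz (2 ^ (Suc T + k))"
  proof -
    have "(2::real) ^ T \<le> 2 ^ (T + k)" by (intro power_increasing) auto
    also have "\<dots> \<le> young_conj sparse_orlicz (2 ^ (Suc T + k))"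
      using young_conj_sparse_orlicz_ge_power[of "T + k"] by simp
    finally show ?thesis using q \<open>real q < 2 ^ T\<close> by linarith
  qed
  ultimately show "\<exists>u>0. N \<le> young_conj sparse_orlicz u
    \<and> 1 / 2 ^ (1 + k + k * Suc k) * young_conj sparse_orlicz u \<le> young_conj sparse_orlicz (u / 2 ^ k)"
    by (intro exI[of _ "2 ^ (Suc T + k)"] conjI) simp_all
qed simp

text \<open>The boundedness clause certifies that the real \<open>SUP\<close> in
  \<open>young_conj\<close> is a true finite supremum, so the last clause concerns the genuine Young
  conjugate.\<close>

theorem mainTheorem12:
  shows "\<exists>\<Phi>. orlicz_function \<Phi>
     \<and> (\<forall>u\<ge>0. bdd_above ((\<lambda>t. u * t - \<Phi> t) ` {0<..}))
     \<and> orlicz_function (young_conj \<Phi>)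
     \<and> one_DH \<Phi> \<and> \<not> DH (young_conj \<Phi>)"
proof (intro exI[of _ sparse_orlicz] conjI allI impI)
  show "\<not> DH (young_conj sparse_orlicz)"
    by (rule not_DH_criterion[OF orlicz_function_young_conj_sparse_orlicz
          young_conj_sparse_orlicz_fast young_conj_sparse_orlicz_slow])
qed (rule orlicz_function_sparse_orlicz sparse_orlicz_conj_bdd
    orlicz_function_young_conj_sparse_orlicz one_DH_sparse_orlicz)+

end
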